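(* Consider the following rows of Gauss words: Row 1: $\{w_1,w_2\}\cup\{w_3,w_4\}$ with $w_1=$ABCDBEACED, $w_2=$ABCDECAEBD, $w_3=$ABCADBECDE, $w_4=$ABCACDEDBE. Row 2: ABCBDAEDCE, ABCDCAEBDE. Row 3: ABCACDBEDE. Row 4: ABACDCEDBE. Row 5: ABACDCEBED, ABCDCAEDEB, ABCBDEDCAE, ABACDEDBCE, ABCDCEBDAE. Row 6: ABCBDCEAED. Row 7: ABCDECEADB. Row 8: ABCDCEDAEB, ABCDEBDACE. Row 9: ABCDEBECAD, ABCDCEBEAD, ABCDCAEBED. Row 10: ABCADBDECE, ABCDBDAECE. Row 11: ABACDCEBDE, ABACDEDBEC. Row 12: ABCADCDEBE. Row 13: ABACBDCEDE. Row 14: ABACDBECED, ABACDBDECE. Row 15: ABCDBEDEAC, ABCDEADBEC. Row 16: ABCBDCEDEA. Row 17: ABACDBCEDE, ABCBDCAEDE, ABACDBEDEC. Row 18: ABCADCEBED, ABCADEBECD. Row 19: ABCADEDCEB. Row 20: ABCBDCEADE, ABCBDEDAEC, ABCDACEDBE, ABCDAEBDEC. Row 21: ABCDEDBECA, ABCBDAECDE, ABCBDEDCEA, ABCDCAEDBE, ABCDCEBDEA. Row 22: ABCDBECAED, ABCDBDEACE, ABCDEACEBD. Row 23: ABCDBEADEC, ABCDECADBE, ABCADEDBEC. Row 24: ABCDCADEBE. Row 25: ABCADECDBE, ABCADBEDEC, ABCDBECADE, ABCDBDEAEC. Row 26: ABCADECEBD, ABCDBECEDA, ABCDECEBDA,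 ABCDBDECEA, ABCADBECED. Row 27: ABACDECEBD. Row 28: ABCDBDECAE. Row 29: ABCBDEAECD, ABCDEDACEB, ABCDCEAEDB. Row 30: ABACBDEDCE. Row 31: ABCDADECEB, ABCDAECEDB, ABCBDADECE, ABCDADBECE, ABCBDECEAD. Row 32: ABCBDAECED. Row 33: ABCBDAEDEC. Row 34: ABCDEDBEAC. Row 35: ABACDCBEDE, ABCBDACEDE. Row 36: ABACDCBD, ABCBDACD, ABCDCADB. Row 37: ABCACDBD, ABCADBDC, ABCDBDAC. Row 38: ABACBDCD. Then: (a) for each $i\in\{2,\dots,38\}$, all words in Row $i$ are homotopic to each other; moreover $w_1$ is homotopic to $w_2$ and $w_3$ is homotopic to $w_4$; (b) a word in Row $i$ is not homotopic to any word in Row $j$ whenever $i\neq j$; (c) every Gauss word of rank at most $5$ that is not isomorphic to a word in the rows above is homotopic to the empty word or to a Gauss word of rank at most $4$. (No assertion is made as to whether $w_1$ is homotopic to $w_3$.)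
   Context: A Gauss word is a finite sequence of letters in which every letter that occurs appears exactly twice (the empty word is allowed). Its rank is the number of distinct letters in it. Two Gauss words are isomorphic if there is a bijection between their sets of letters which transforms the first word into the second. Homotopy moves, for arbitrary (possibly empty) words $x,y,z,t$ such that both sides are Gauss words: (H1) $xAAy\leftrightarrow xy$; (H2) $xAByBAz\leftrightarrow xyz$; (H3) $xAByACzBCt\leftrightarrow xBAyCAzCBt$. Homotopy is the equivalence relation on Gauss words generated by isomorphism and the moves H1–H3. *)

theory Defs
  imports Main
begin

text \<open>
  Words are lists over an arbitrary type of letters. Homotopy may pass through words with many
  letters, so it is the intended relation only over an infinite type; the theorem uses \<^typ>\<open>nat\<close>.
\<close>

definition gauss_word :: "'a list \<Rightarrow> bool" where
  "gauss_word w \<longleftrightarrow> (\<forall>a\<in>set w. count_list w a = 2)"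

definition word_rank :: "'a list \<Rightarrow> nat" where
  "word_rank w = card (set w)"

definition isomorphic :: "'a list \<Rightarrow> 'b list \<Rightarrow> bool" where
  "isomorphic u v \<longleftrightarrow> (\<exists>f. bij_betw f (set u) (set v) \<and> map f u = v)"

text \<open>
  The letters named in a move are automatically distinct from each other and from the letters of
  \<open>x\<close>, \<open>y\<close>, \<open>z\<close>, \<open>t\<close> once both sides are required to be Gauss words.
\<close>

inductive move :: "'a list \<Rightarrow> 'a list \<Rightarrow> bool" where
  H1: "move (x @ [A, A] @ y) (x @ y)"
| H2: "move (x @ [A, B] @ y @ [B, A] @ z) (x @ y @ z)"
| H3: "move (x @ [A, B] @ y @ [A, C] @ z @ [B, C] @ t) (x @ [B, A] @ y @ [C, A] @ z @ [C, B] @ t)"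

definition homotopy_step :: "'a list \<Rightarrow> 'a list \<Rightarrow> bool" where
  "homotopy_step u v \<longleftrightarrow> gauss_word u \<and> gauss_word v \<and> (isomorphic u v \<or> move u v)"

text \<open>\<^const>\<open>equivclp\<close> is reflexive on all lists, whence the restriction to Gauss words.\<close>

definition homotopic :: "'a list \<Rightarrow> 'a list \<Rightarrow> bool" where
  "homotopic u v \<longleftrightarrow> gauss_word u \<and> gauss_word v \<and> equivclp homotopy_step u v"

text \<open>The letters \<open>A\<close>, \<dots>, \<open>E\<close> become pairwise distinct natural numbers (their character codes).\<close>

definition word_of :: "string \<Rightarrow> nat list" where
  "word_of s = map of_char s"

definition w1 :: "nat list" where "w1 = word_of ''ABCDBEACED''"
definition w2 :: "nat list" where "w2 = word_of ''ABCDECAEBD''"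
definition w3 :: "nat list" where "w3 = word_of ''ABCADBECDE''"
definition w4 :: "nat list" where "w4 = word_of ''ABCACDEDBE''"

definition rows_from_2 :: "string list list" where
  "rows_from_2 =
    [
     [''ABCBDAEDCE'', ''ABCDCAEBDE''],
     [''ABCACDBEDE''],
     [''ABACDCEDBE''],
     [''ABACDCEBED'', ''ABCDCAEDEB'', ''ABCBDEDCAE'', ''ABACDEDBCE'', ''ABCDCEBDAE''],
     [''ABCBDCEAED''],
     [''ABCDECEADB''],
     [''ABCDCEDAEB'', ''ABCDEBDACE''],
     [''ABCDEBECAD'', ''ABCDCEBEAD'', ''ABCDCAEBED''],
     [''ABCADBDECE'', ''ABCDBDAECE''],
     [''ABACDCEBDE'', ''ABACDEDBEC''],
     [''ABCADCDEBE''],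
     [''ABACBDCEDE''],
     [''ABACDBECED'', ''ABACDBDECE''],
     [''ABCDBEDEAC'', ''ABCDEADBEC''],
     [''ABCBDCEDEA''],
     [''ABACDBCEDE'', ''ABCBDCAEDE'', ''ABACDBEDEC''],
     [''ABCADCEBED'', ''ABCADEBECD''],
     [''ABCADEDCEB''],
     [''ABCBDCEADE'', ''ABCBDEDAEC'', ''ABCDACEDBE'', ''ABCDAEBDEC''],
     [''ABCDEDBECA'', ''ABCBDAECDE'', ''ABCBDEDCEA'', ''ABCDCAEDBE'', ''ABCDCEBDEA''],
     [''ABCDBECAED'', ''ABCDBDEACE'', ''ABCDEACEBD''],
     [''ABCDBEADEC'', ''ABCDECADBE'', ''ABCADEDBEC''],
     [''ABCDCADEBE''],
     [''ABCADECDBE'', ''ABCADBEDEC'', ''ABCDBECADE'', ''ABCDBDEAEC''],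
     [''ABCADECEBD'', ''ABCDBECEDA'', ''ABCDECEBDA'', ''ABCDBDECEA'', ''ABCADBECED''],
     [''ABACDECEBD''],
     [''ABCDBDECAE''],
     [''ABCBDEAECD'', ''ABCDEDACEB'', ''ABCDCEAEDB''],
     [''ABACBDEDCE''],
     [''ABCDADECEB'', ''ABCDAECEDB'', ''ABCBDADECE'', ''ABCDADBECE'', ''ABCBDECEAD''],
     [''ABCBDAECED''],
     [''ABCBDAEDEC''],
     [''ABCDEDBEAC''],
     [''ABACDCBEDE'', ''ABCBDACEDE''],
     [''ABACDCBD'', ''ABCBDACD'', ''ABCDCADB''],
     [''ABCACDBD'', ''ABCADBDC'', ''ABCDBDAC''],
     [''ABACBDCD'']
    ]"

text \<open>Meaningful for \<open>1 \<le> i \<le> 38\<close> only.\<close>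

definition table_row :: "nat \<Rightarrow> nat list set" where
  "table_row i = (if i = 1 then {w1, w2} \<union> {w3, w4} else word_of ` set (rows_from_2 ! (i - 2)))"

end

theory Submission
  imports Defs
begin

text \<open>
  H2 and H3 generate their variants with other orders of the letters (\<open>ABAB\<close> for H2, all eight orders
  for H3). With these, every reduction and every equivalence claimed by the table takes place among
  words of rank at most 5, and a search through the 945 words of rank 5 establishes it.

  For the negative part, call a letter even if an even number of letters lie between its two
  occurrences. Parity is preserved by the moves; the letters of a bigon have the same parity, and
  the number of even letters in a triangle is odd. So the number modulo 2 of subwords of a word that
  belong to a given set \<open>P\<close> of words with labelled letters is invariant as soon as no member
  of \<open>P\<close> has an even letter in two neighbouring places or a bigon of equally labelled letters, and a
  certain parity condition holds for each triangle. If the members of \<open>P\<close> have rank at most 4, then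
  the last condition has to be tested only where at most two letters lie outside the triangle. Seven
  sets \<open>P\<close>, found by linear algebra over the field with two elements, separate the rows.
\<close>

section \<open>Moves and derived moves\<close>

lemma gauss_word_iff: "gauss_word w \<longleftrightarrow> (\<forall>a. count_list w a = 0 \<or> count_list w a = 2)"
  unfolding gauss_word_def by (metis count_list_0_iff)

lemma gauss_word_cong:
  assumes "gauss_word u" "\<And>a. count_list u a = count_list v a"
  shows "gauss_word v"
  using assms by (simp add: gauss_word_iff)

lemma gauss_word_insert:
  assumes "gauss_word u" "D \<notin> set u" "\<And>a. count_list v a = count_list (D # D # u) a"
  shows "gauss_word v"
  using assms by (auto simp: gauss_word_iff)

lemma gauss_word_insert2:
  assumes "gauss_word u" "D \<notin> set u" "E \<notin> set u" "D \<noteq> E"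
    "\<And>a. count_list v a = count_list (D # D # E # E # u) a"
  shows "gauss_word v"
  using assms by (auto simp: gauss_word_iff)

text \<open>Both occurrences of a letter of \<open>p\<close> are used up by \<open>p\<close>, so it
  is absent from \<open>v\<close>; every other letter keeps its count.\<close>

lemma gauss_word_delete:
  assumes "gauss_word u" "\<And>a. count_list u a = count_list v a + count_list p a"
    "\<And>a. a \<in> set p \<Longrightarrow> count_list p a \<ge> 2"
  shows "gauss_word v"
  unfolding gauss_word_iff
proof
  fix a
  show "count_list v a = 0 \<or> count_list v a = 2"
  proof (cases "a \<in> set p")
    case True
    then show ?thesis using assms(1) assms(2)[of a] assms(3)[of a] unfolding gauss_word_iff
      by (metis add_is_0 add_le_same_cancel2 le_zero_eq zero_neq_numeral nle_le)
  next
    case False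
    then show ?thesis using assms(1) assms(2)[of a] unfolding gauss_word_iff
      by (metis add.right_neutral count_list_0_iff)
  qed
qed

lemma count_list_map_inj_on:
  "inj_on f (insert a (set u)) \<Longrightarrow> count_list (map f u) (f a) = count_list u a"
  by (induction u) (auto simp: inj_on_def)

lemma gauss_word_map:
  assumes "gauss_word u" "inj_on f (set u)"
  shows "gauss_word (map f u)"
  using assms by (auto simp: gauss_word_def count_list_map_inj_on insert_absorb)

lemma homotopic_refl: "gauss_word u \<Longrightarrow> homotopic u u"
  by (simp add: homotopic_def)

lemma homotopic_sym: "homotopic u v \<Longrightarrow> homotopic v u"
  unfolding homotopic_def using equivclp_sym by metis

lemma homotopic_trans [trans]: "homotopic u v \<Longrightarrow> homotopic v w \<Longrightarrow> homotopic u w"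
  unfolding homotopic_def using equivclp_trans by metis

lemma homotopic_gauss:
  "homotopic u v \<Longrightarrow> gauss_word u" "homotopic u v \<Longrightarrow> gauss_word v"
  by (simp_all add: homotopic_def)

lemma homotopic_move: "gauss_word u \<Longrightarrow> gauss_word v \<Longrightarrow> move u v \<Longrightarrow> homotopic u v"
  unfolding homotopic_def homotopy_step_def by (blast intro: r_into_equivclp)

lemma homotopic_isomorphic:
  fixes u v :: "'a list"
  shows "gauss_word u \<Longrightarrow> gauss_word v \<Longrightarrow> isomorphic u v \<Longrightarrow> homotopic u v"
  unfolding homotopic_def homotopy_step_def by (blast intro: r_into_equivclp)

lemma homotopic_map:
  fixes f :: "'a \<Rightarrow> 'a"
  assumes "gauss_word u" "inj_on f (set u)"
  shows "homotopic u (map f u)"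
  using assms by (intro homotopic_isomorphic gauss_word_map)
    (auto simp: isomorphic_def bij_betw_def)

lemma homotopic_rename:
  assumes "gauss_word w" "D \<notin> set w"
  shows "homotopic w (map (id(B := D)) w)"
  using assms by (intro homotopic_map) (auto simp: inj_on_def)

lemma homotopic_H1:
  assumes "gauss_word (x @ [A, A] @ y)"
  shows "homotopic (x @ [A, A] @ y) (x @ y)"
  by (rule homotopic_move[OF assms gauss_word_delete[OF assms, of _ "[A, A]"] move.H1]) auto

lemma homotopic_H2:
  assumes "gauss_word (x @ [A, B] @ y @ [B, A] @ z)"
  shows "homotopic (x @ [A, B] @ y @ [B, A] @ z) (x @ y @ z)"
  by (rule homotopic_move[OF assms gauss_word_delete[OF assms, of _ "[A, B, A, B]"] move.H2]) auto

lemma homotopic_H3: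
  assumes "gauss_word (x @ [A, B] @ y @ [A, C] @ z @ [B, C] @ t)"
  shows "homotopic (x @ [A, B] @ y @ [A, C] @ z @ [B, C] @ t)
    (x @ [B, A] @ y @ [C, A] @ z @ [C, B] @ t)"
  by (intro homotopic_move[OF assms _ move.H3] gauss_word_cong[OF assms]) auto

lemma homotopic_H3_rev:
  assumes "gauss_word (x @ [B, A] @ y @ [C, A] @ z @ [C, B] @ t)"
  shows "homotopic (x @ [B, A] @ y @ [C, A] @ z @ [C, B] @ t)
    (x @ [A, B] @ y @ [A, C] @ z @ [B, C] @ t)"
  by (intro homotopic_sym[OF homotopic_H3] gauss_word_cong[OF assms]) auto

section \<open>Other orders of the letters in H2 and H3\<close>

lemma two_fresh:
  fixes w :: "nat list"
  obtains D E where "D \<notin> set w" "E \<notin> set w" "D \<noteq> E"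
proof -
  have "infinite (UNIV - set w)" by simp
  then obtain D where "D \<in> UNIV - set w" using infinite_imp_nonempty by blast
  moreover have "infinite (UNIV - set (D # w))" by simp
  then obtain E where "E \<in> UNIV - set (D # w)" using infinite_imp_nonempty by blast
  ultimately show thesis using that[of D E] by auto
qed

lemma homotopic_H2_insert:
  assumes "gauss_word (x @ y @ z)" "A \<notin> set (x @ y @ z)" "B \<notin> set (x @ y @ z)" "A \<noteq> B"
  shows "homotopic (x @ y @ z) (x @ [A, B] @ y @ [B, A] @ z)"
  by (intro homotopic_sym[OF homotopic_H2] gauss_word_insert2[OF assms]) auto

text \<open>A new bigon \<open>D\<close>, \<open>E\<close> is inserted so that \<open>E\<close>,
  \<open>A\<close>, \<open>C\<close> form a triangle in the order of the right-hand side of H3.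
  Sliding it makes \<open>E\<close> and \<open>B\<close> a bigon, which cancels, and
  \<open>D\<close> remains in the place of \<open>B\<close>.\<close>

lemma homotopic_H3_variant1:
  fixes A :: nat
  assumes G: "gauss_word (x @ [A, B] @ y @ [C, A] @ z @ [B, C] @ t)"
  shows "homotopic (x @ [A, B] @ y @ [C, A] @ z @ [B, C] @ t) (x @ [B, A] @ y @ [A, C] @ z @ [C, B] @ t)"
    (is "homotopic ?u ?v")
proof -
  obtain D E where fresh: "D \<notin> set ?u" "E \<notin> set ?u" "D \<noteq> E" by (rule two_fresh)
  have "count_list ?u B = 2" using G unfolding gauss_word_def by simp
  then have B: "A \<noteq> B" "C \<noteq> B" "B \<notin> set x" "B \<notin> set y" "B \<notin> set z" "B \<notin> set t"
    by (auto simp: count_list_0_iff split: if_splits)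
  have "homotopic ?u (x @ [D, E, A, B] @ y @ [C, A] @ z @ [B, C, E, D] @ t)"
    using homotopic_H2_insert[of x "[A, B] @ y @ [C, A] @ z @ [B, C]" t D E] G fresh by simp
  also have "homotopic \<dots> (x @ [D, A, E, B] @ y @ [A, C] @ z @ [B, E, C, D] @ t)"
    using homotopic_H3_rev[of "x @ [D]" E A "B # y" C "z @ [B]" "D # t"]
      homotopic_gauss(2)[OF calculation] by simp
  also have "homotopic \<dots> (x @ [D, A] @ y @ [A, C] @ z @ [C, D] @ t)"
    using homotopic_H2[of "x @ [D, A]" E B "y @ [A, C] @ z" "[C, D] @ t"]
      homotopic_gauss(2)[OF calculation] by simp
  also have "homotopic \<dots> (x @ [B, A] @ y @ [A, C] @ z @ [C, B] @ t)"
    using homotopic_rename[of "x @ [D, A] @ y @ [A, C] @ z @ [C, D] @ t" B D]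
      homotopic_gauss(2)[OF calculation] B fresh by auto
  finally show ?thesis .
qed

text \<open>Two new bigons supply a triangle \<open>H\<close>, \<open>A\<close>, \<open>E\<close> in
  the order of the right-hand side of H3. After the slide \<open>H\<close> cancels against
  \<open>B\<close> and \<open>E\<close> against \<open>C\<close>, and the partners \<open>F\<close>
  and \<open>D\<close> take over the names \<open>B\<close> and \<open>C\<close>.\<close>

lemma homotopic_H3_variant2:
  fixes A :: nat
  assumes G: "gauss_word (x @ [A, B] @ y @ [A, C] @ z @ [C, B] @ t)"
  shows "homotopic (x @ [A, B] @ y @ [A, C] @ z @ [C, B] @ t) (x @ [B, A] @ y @ [C, A] @ z @ [B, C] @ t)"
    (is "homotopic ?u ?v")
proof -
  obtain D E where fresh: "D \<notin> set ?u" "E \<notin> set ?u" "D \<noteq> E" by (rule two_fresh)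
  obtain F H where fresh': "F \<notin> set ([D, E] @ ?u)" "H \<notin> set ([D, E] @ ?u)" "F \<noteq> H"
    by (rule two_fresh)
  have "count_list ?u B = 2" using G unfolding gauss_word_def by simp
  then have B: "A \<noteq> B" "C \<noteq> B" "B \<notin> set x" "B \<notin> set y" "B \<notin> set z" "B \<notin> set t"
    by (auto simp: count_list_0_iff split: if_splits)
  have "count_list ?u C = 2" using G unfolding gauss_word_def by simp
  then have C: "A \<noteq> C" "C \<notin> set x" "C \<notin> set y" "C \<notin> set z" "C \<notin> set t"
    by (auto simp: count_list_0_iff split: if_splits)
  have "homotopic ?u (x @ [A, B] @ y @ [D, E, A, C] @ z @ [C, B, E, D] @ t)"
    using homotopic_H2_insert[of "x @ [A, B] @ y" "[A, C] @ z @ [C, B]" t D E] G fresh by simp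
  also have "homotopic \<dots> (x @ [F, H, A, B] @ y @ [D, E, A, C] @ z @ [C, B, E, H, F, D] @ t)"
    using homotopic_H2_insert[of x "[A, B] @ y @ [D, E, A, C] @ z @ [C, B, E]" "[D] @ t" F H]
      homotopic_gauss(2)[OF calculation] fresh' by simp
  also have "homotopic \<dots> (x @ [F, A, H, B] @ y @ [D, A, E, C] @ z @ [C, B, H, E, F, D] @ t)"
    using homotopic_H3_rev[of "x @ [F]" H A "[B] @ y @ [D]" E "[C] @ z @ [C, B]" "[F, D] @ t"]
      homotopic_gauss(2)[OF calculation] by simp
  also have "homotopic \<dots> (x @ [F, A] @ y @ [D, A, E, C] @ z @ [C, E, F, D] @ t)"
    using homotopic_H2[of "x @ [F, A]" H B "y @ [D, A, E, C] @ z @ [C]" "[E, F, D] @ t"]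
      homotopic_gauss(2)[OF calculation] by simp
  also have "homotopic \<dots> (x @ [F, A] @ y @ [D, A] @ z @ [F, D] @ t)"
    using homotopic_H2[of "x @ [F, A] @ y @ [D, A]" E C z "[F, D] @ t"]
      homotopic_gauss(2)[OF calculation] by simp
  also have "homotopic \<dots> (x @ [B, A] @ y @ [D, A] @ z @ [B, D] @ t)"
    using homotopic_rename[of "x @ [F, A] @ y @ [D, A] @ z @ [F, D] @ t" B F]
      homotopic_gauss(2)[OF calculation] B fresh fresh' by auto
  also have "homotopic \<dots> (x @ [B, A] @ y @ [C, A] @ z @ [B, C] @ t)"
    using homotopic_rename[of "x @ [B, A] @ y @ [D, A] @ z @ [B, D] @ t" C D]
      homotopic_gauss(2)[OF calculation] B C fresh by auto
  finally show ?thesis .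
qed

text \<open>Here the triangle that slides is \<open>D\<close>, \<open>F\<close>, \<open>C\<close>,
  with \<open>D\<close> and \<open>F\<close> taken from two new bigons. Afterwards \<open>B\<close>
  cancels against \<open>F\<close> and \<open>A\<close> against \<open>D\<close>; the partners
  \<open>H\<close> and \<open>E\<close> take their places.\<close>

lemma homotopic_H3_variant3:
  fixes A :: nat
  assumes G: "gauss_word (x @ [A, B] @ y @ [C, A] @ z @ [C, B] @ t)"
  shows "homotopic (x @ [A, B] @ y @ [C, A] @ z @ [C, B] @ t) (x @ [B, A] @ y @ [A, C] @ z @ [B, C] @ t)"
    (is "homotopic ?u ?v")
proof -
  obtain D E where fresh: "D \<notin> set ?u" "E \<notin> set ?u" "D \<noteq> E" by (rule two_fresh)
  obtain F H where fresh': "F \<notin> set ([D, E] @ ?u)" "H \<notin> set ([D, E] @ ?u)" "F \<noteq> H"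
    by (rule two_fresh)
  have "count_list ?u B = 2" using G unfolding gauss_word_def by simp
  then have B: "A \<noteq> B" "C \<noteq> B" "B \<notin> set x" "B \<notin> set y" "B \<notin> set z" "B \<notin> set t"
    by (auto simp: count_list_0_iff split: if_splits)
  have "count_list ?u A = 2" using G unfolding gauss_word_def by simp
  then have A: "A \<noteq> C" "A \<notin> set x" "A \<notin> set y" "A \<notin> set z" "A \<notin> set t"
    by (auto simp: count_list_0_iff split: if_splits)
  have "homotopic ?u (x @ [A, B, D, E] @ y @ [E, D, C, A] @ z @ [C, B] @ t)"
    using homotopic_H2_insert[of "x @ [A, B]" y "[C, A] @ z @ [C, B] @ t" D E] G fresh by simp
  also have "homotopic \<dots> (x @ [A, B, D, F, H, E] @ y @ [E, D, C, A] @ z @ [H, F, C, B] @ t)"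
    using homotopic_H2_insert[of "x @ [A, B, D]" "[E] @ y @ [E, D, C, A] @ z" "[C, B] @ t" F H]
      homotopic_gauss(2)[OF calculation] fresh' by simp
  also have "homotopic \<dots> (x @ [A, B, F, D, H, E] @ y @ [E, C, D, A] @ z @ [H, C, F, B] @ t)"
    using homotopic_H3[of "x @ [A, B]" D F "[H, E] @ y @ [E]" C "[A] @ z @ [H]" "[B] @ t"]
      homotopic_gauss(2)[OF calculation] by simp
  also have "homotopic \<dots> (x @ [A, D, H, E] @ y @ [E, C, D, A] @ z @ [H, C] @ t)"
    using homotopic_H2[of "x @ [A]" B F "[D, H, E] @ y @ [E, C, D, A] @ z @ [H, C]" t]
      homotopic_gauss(2)[OF calculation] by simp
  also have "homotopic \<dots> (x @ [H, E] @ y @ [E, C] @ z @ [H, C] @ t)"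
    using homotopic_H2[of x A D "[H, E] @ y @ [E, C]" "z @ [H, C] @ t"]
      homotopic_gauss(2)[OF calculation] by simp
  also have "homotopic \<dots> (x @ [B, E] @ y @ [E, C] @ z @ [B, C] @ t)"
    using homotopic_rename[of "x @ [H, E] @ y @ [E, C] @ z @ [H, C] @ t" B H]
      homotopic_gauss(2)[OF calculation] B fresh fresh' by auto
  also have "homotopic \<dots> (x @ [B, A] @ y @ [A, C] @ z @ [B, C] @ t)"
    using homotopic_rename[of "x @ [B, E] @ y @ [E, C] @ z @ [B, C] @ t" A E]
      homotopic_gauss(2)[OF calculation] A B fresh by auto
  finally show ?thesis .
qed

text \<open>Two new bigons give a triangle \<open>H\<close>, \<open>E\<close>, \<open>B\<close>.
  After its slide \<open>H\<close> cancels against \<open>A\<close>, the letter \<open>E\<close>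
  becomes a loop, and then \<open>F\<close>, \<open>B\<close> form a bigon in the order of H2, whose
  removal leaves the loop \<open>D\<close>.\<close>

lemma homotopic_H2_variant:
  fixes A :: nat
  assumes G: "gauss_word (x @ [A, B] @ y @ [A, B] @ z)"
  shows "homotopic (x @ [A, B] @ y @ [A, B] @ z) (x @ y @ z)"
    (is "homotopic ?u ?v")
proof -
  obtain D E where fresh: "D \<notin> set ?u" "E \<notin> set ?u" "D \<noteq> E" by (rule two_fresh)
  obtain F H where fresh': "F \<notin> set ([D, E] @ ?u)" "H \<notin> set ([D, E] @ ?u)" "F \<noteq> H"
    by (rule two_fresh)
  have "homotopic ?u (x @ [D, E, A, B, E, D] @ y @ [A, B] @ z)"
    using homotopic_H2_insert[of x "[A, B]" "y @ [A, B] @ z" D E] G fresh by simp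
  also have "homotopic \<dots> (x @ [D, F, H, E, A, B, E, D] @ y @ [A, B, H, F] @ z)"
    using homotopic_H2_insert[of "x @ [D]" "[E, A, B, E, D] @ y @ [A, B]" z F H]
      homotopic_gauss(2)[OF calculation] fresh' by simp
  also have "homotopic \<dots> (x @ [D, F, E, H, A, E, B, D] @ y @ [A, H, B, F] @ z)"
    using homotopic_H3_rev[of "x @ [D, F]" H E "[A]" B "[D] @ y @ [A]" "[F] @ z"]
      homotopic_gauss(2)[OF calculation] by simp
  also have "homotopic \<dots> (x @ [D, F, E, E, B, D] @ y @ [B, F] @ z)"
    using homotopic_H2[of "x @ [D, F, E]" H A "[E, B, D] @ y" "[B, F] @ z"]
      homotopic_gauss(2)[OF calculation] by simp
  also have "homotopic \<dots> (x @ [D, F, B, D] @ y @ [B, F] @ z)"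
    using homotopic_H1[of "x @ [D, F]" E "[B, D] @ y @ [B, F] @ z"]
      homotopic_gauss(2)[OF calculation] by simp
  also have "homotopic \<dots> (x @ [D, D] @ y @ z)"
    using homotopic_H2[of "x @ [D]" F B "[D] @ y" z]
      homotopic_gauss(2)[OF calculation] by simp
  also have "homotopic \<dots> (x @ y @ z)"
    using homotopic_H1[of x D "y @ z"] homotopic_gauss(2)[OF calculation] by simp
  finally show ?thesis .
qed

section \<open>Canonical forms\<close>

fun first_pos :: "'a list \<Rightarrow> 'a \<Rightarrow> nat" where
  "first_pos [] a = 0"
| "first_pos (b # w) a = (if b = a then 0 else Suc (first_pos w a))"

text \<open>Taking positions of first occurrences as names needs no counter, and indexing into
  \<open>w\<close> recovers the letter from its name.\<close>

definition canon :: "'a list \<Rightarrow> nat list" where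
  "canon w = map (first_pos w) w"

lemma length_canon [simp]: "length (canon w) = length w"
  by (simp add: canon_def)

lemma nth_first_pos: "a \<in> set w \<Longrightarrow> w ! first_pos w a = a"
  by (induction w) auto

lemma first_pos_map:
  "inj_on f (insert a (set w)) \<Longrightarrow> first_pos (map f w) (f a) = first_pos w a"
  by (induction w) (auto simp: inj_on_def)

lemma canon_map: "inj_on f (set w) \<Longrightarrow> canon (map f w) = canon w"
  by (simp add: canon_def first_pos_map insert_absorb)

lemma isomorphic_if_canon_eq:
  assumes "canon u = canon v"
  shows "isomorphic u v"
proof -
  have len: "length u = length v" using assms by (metis length_canon)
  have pos: "first_pos u (u ! i) = first_pos v (v ! i)" if "i < length u" for i
    using assms that len unfolding canon_def by (metis nth_map)
  \<comment> \<open>Read the letter of \<open>v\<close> at the place where \<open>a\<close> first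
    occurs in \<open>u\<close>; equal canonical forms make this the letter facing every occurrence
    of \<open>a\<close>.\<close>
  let ?f = "\<lambda>a. v ! first_pos u a"
  have map: "map ?f u = v"
    by (rule nth_equalityI) (auto simp: len pos nth_first_pos)
  have "inj_on ?f (set u)"
  proof (rule inj_onI)
    fix a b assume "a \<in> set u" "b \<in> set u" and eq: "?f a = ?f b"
    then obtain i j where ij: "i < length u" "a = u ! i" "j < length u" "b = u ! j"
      by (metis in_set_conv_nth)
    then have "v ! i = v ! j" using eq map by (metis nth_map)
    then have "first_pos u a = first_pos u b" using ij pos by simp
    then show "a = b" using \<open>a \<in> set u\<close> \<open>b \<in> set u\<close> nth_first_pos by metis
  qed
  moreover have "?f ` set u = set v" using map by (metis list.set_map)
  ultimately show ?thesis unfolding isomorphic_def bij_betw_def using map by blast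
qed

lemma gauss_word_canon: "canon u = canon v \<Longrightarrow> gauss_word u \<Longrightarrow> gauss_word v"
  using isomorphic_if_canon_eq gauss_word_map unfolding isomorphic_def bij_betw_def by metis

lemma homotopic_if_canon_eq:
  fixes u v :: "'a list"
  shows "gauss_word u \<Longrightarrow> canon u = canon v \<Longrightarrow> homotopic u v"
  by (intro homotopic_isomorphic isomorphic_if_canon_eq) (auto intro: gauss_word_canon)

lemma gauss_word_length: "gauss_word w \<Longrightarrow> length w = 2 * word_rank w"
  using sum_count_set[of w "set w"] by (simp add: gauss_word_def word_rank_def)

section \<open>Enumeration of Gauss words up to isomorphism\<close>

fun splits :: "'a list \<Rightarrow> ('a list \<times> 'a list) list" where
  "splits [] = [([], [])]"
| "splits (a # w) = ([], a # w) # map (\<lambda>(u, v). (a # u, v)) (splits w)"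

lemma set_splits: "set (splits w) = {(u, v). w = u @ v}"
  by (induction w) (auto simp: Cons_eq_append_conv image_iff)

text \<open>The opening letter of a word of rank \<open>Suc n\<close> is named \<open>n\<close>, and
  its second occurrence may stand anywhere in the rest. Thus every isomorphism class is met exactly
  once: 1 * 3 * 5 * 7 * 9 = 945 words of rank 5.\<close>

fun gauss_words :: "nat \<Rightarrow> nat list list" where
  "gauss_words 0 = [[]]"
| "gauss_words (Suc n) = [n # u @ n # v. w \<leftarrow> gauss_words n, (u, v) \<leftarrow> splits w]"

lemma gauss_words_SucD:
  assumes "c \<in> set (gauss_words (Suc n))"
  obtains u v where "c = n # u @ n # v" "u @ v \<in> set (gauss_words n)"
  using assms by (auto simp: set_splits)

lemma set_gauss_words: "c \<in> set (gauss_words n) \<Longrightarrow> set c = {..<n}"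
proof (induction n arbitrary: c)
  case (Suc n)
  then obtain u v where "c = n # u @ n # v" "set (u @ v) = {..<n}"
    by (metis gauss_words_SucD)
  then show ?case by (auto simp: lessThan_Suc)
qed simp

lemma gauss_word_gauss_words: "c \<in> set (gauss_words n) \<Longrightarrow> gauss_word c"
proof (induction n arbitrary: c)
  case (Suc n)
  then obtain u v where uv: "c = n # u @ n # v" "u @ v \<in> set (gauss_words n)"
    by (metis gauss_words_SucD)
  have "n \<notin> set (u @ v)" unfolding set_gauss_words[OF uv(2)] by simp
  then show ?case
    by (rule gauss_word_insert[OF Suc.IH[OF uv(2)]]) (simp add: uv)
qed (simp add: gauss_word_def)

text \<open>Delete the first letter and its mate, apply induction to the rest, and extend the naming
  by sending \<open>n\<close> to that letter.\<close>

lemma gauss_words_complete: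
  assumes "gauss_word w" "length w = 2 * n"
  shows "\<exists>c\<in>set (gauss_words n). \<exists>f. inj_on f {..<n} \<and> w = map f c"
  using assms
proof (induction n arbitrary: w)
  case (Suc n)
  then obtain a w' where w: "w = a # w'" by (cases w) auto
  have "count_list w' a = 1" using Suc.prems(1) w by (auto simp: gauss_word_def)
  then have "a \<in> set w'" by (metis count_list_0_iff zero_neq_one)
  then obtain u v where uv: "w' = u @ a # v" by (metis split_list)
  have a: "a \<notin> set (u @ v)" using \<open>count_list w' a = 1\<close> uv by (auto simp: count_list_0_iff)
  have "gauss_word (u @ v)"
    by (rule gauss_word_delete[OF Suc.prems(1), of _ "[a, a]"]) (auto simp: w uv)
  moreover have "length (u @ v) = 2 * n" using Suc.prems(2) w uv by simp
  ultimately obtain c f where c: "c \<in> set (gauss_words n)" "inj_on f {..<n}" "u @ v = map f c"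
    using Suc.IH by blast
  then obtain u' v' where c': "c = u' @ v'" "u = map f u'" "v = map f v'"
    by (metis append_eq_map_conv)
  let ?f = "f(n := a)"
  have set: "set u' \<union> set v' = {..<n}" using set_gauss_words[OF c(1)] c' by auto
  then have "n \<notin> set u'" "n \<notin> set v'" by blast+
  then have "w = map ?f (n # u' @ n # v')" using w uv c' by simp
  moreover have "n # u' @ n # v' \<in> set (gauss_words (Suc n))"
    using c(1) c' by (force simp: set_splits)
  moreover have "a \<notin> f ` {..<n}" using a c(3) set_gauss_words[OF c(1)] by (metis list.set_map)
  then have "inj_on ?f {..<Suc n}"
    using c(2) by (auto simp: inj_on_def lessThan_Suc image_iff)
  ultimately show ?case by blast
qed simp

section \<open>Reduction of words\<close>

lemma canon_canon [simp]: "canon (canon w) = canon w"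
proof -
  have "inj_on (first_pos w) (set w)"
    by (rule inj_on_inverseI[of _ "(!) w"]) (rule nth_first_pos)
  then show ?thesis using canon_map unfolding canon_def by metis
qed

fun has_loop :: "'a list \<Rightarrow> bool" where
  "has_loop (a # b # w) \<longleftrightarrow> a = b \<or> has_loop (b # w)"
| "has_loop _ \<longleftrightarrow> False"

fun adjacent :: "'a \<Rightarrow> 'a \<Rightarrow> 'a list \<Rightarrow> bool" where
  "adjacent a b (c # d # w) \<longleftrightarrow> c = a \<and> d = b \<or> c = b \<and> d = a \<or> adjacent a b (d # w)"
| "adjacent a b _ \<longleftrightarrow> False"

text \<open>The second pair is sought in \<open>w\<close>, not in \<open>b # w\<close>, so that the
  two pairs do not overlap. Both orders of the second pair count, H2 having been derived for
  both.\<close>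

fun has_bigon :: "'a list \<Rightarrow> bool" where
  "has_bigon (a # b # w) \<longleftrightarrow> adjacent a b w \<or> has_bigon (b # w)"
| "has_bigon _ \<longleftrightarrow> False"

lemma has_loopD: "has_loop w \<Longrightarrow> \<exists>x A y. w = x @ [A, A] @ y"
proof (induction w rule: has_loop.induct)
  case (1 a b w)
  then show ?case by (metis append_Cons append_Nil has_loop.simps(1))
qed auto

lemma adjacentD: "adjacent a b w \<Longrightarrow> \<exists>y z. w = y @ [a, b] @ z \<or> w = y @ [b, a] @ z"
proof (induction a b w rule: adjacent.induct)
  case (1 a b c d w)
  then show ?case by (metis append_Cons append_Nil adjacent.simps(1))
qed auto

lemma has_bigonD:
  "has_bigon w \<Longrightarrow> \<exists>x A B y z. w = x @ [A, B] @ y @ [A, B] @ z \<or> w = x @ [A, B] @ y @ [B, A] @ z"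
proof (induction w rule: has_bigon.induct)
  case (1 a b w)
  show ?case
  proof (cases "adjacent a b w")
    case True
    then show ?thesis using adjacentD[OF True] by (metis append_Cons append_Nil)
  next
    case False
    then show ?thesis using 1 by (metis append_Cons has_bigon.simps(1))
  qed
qed auto

lemma reducible:
  fixes w :: "nat list"
  assumes "gauss_word w" "has_loop w \<or> has_bigon w"
  shows "\<exists>v. homotopic w v \<and> word_rank v < word_rank w"
proof -
  have "\<exists>v. homotopic w v \<and> length v < length w"
    using assms(2)
  proof
    assume "has_loop w"
    then obtain x A y where w: "w = x @ [A, A] @ y" using has_loopD by blast
    then show ?thesis using assms(1) homotopic_H1[of x A y] by (intro exI[of _ "x @ y"]) simp
  next
    assume "has_bigon w"
    then obtain x A B y z where "w = x @ [A, B] @ y @ [A, B] @ z \<or> w = x @ [A, B] @ y @ [B, A] @ z"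
      using has_bigonD by blast
    then show ?thesis
      using assms(1) homotopic_H2[of x A B y z] homotopic_H2_variant[of x A B y z]
      by (intro exI[of _ "x @ y @ z"]) auto
  qed
  then show ?thesis using gauss_word_length homotopic_gauss by (metis nat_mult_less_cancel_disj)
qed

section \<open>Triangle slides and searches along them\<close>

fun pairs :: "'a list \<Rightarrow> ('a list \<times> 'a \<times> 'a \<times> 'a list) list" where
  "pairs (p # q # w) = ([], p, q, w) # map (\<lambda>(x, r). (p # x, r)) (pairs (q # w))"
| "pairs _ = []"

lemma set_pairs: "(x, p, q, r) \<in> set (pairs w) \<Longrightarrow> w = x @ [p, q] @ r"
  by (induction w arbitrary: x rule: pairs.induct) auto

definition triangle :: "'a \<Rightarrow> 'a \<Rightarrow> 'a \<Rightarrow> 'a \<Rightarrow> 'a \<Rightarrow> 'a \<Rightarrow> bool" where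
  "triangle p q r s u v \<longleftrightarrow>
    r = p \<and> (u = q \<and> v = s \<or> u = s \<and> v = q) \<or> s = p \<and> (u = q \<and> v = r \<or> u = r \<and> v = q) \<or>
    r = q \<and> (u = p \<and> v = s \<or> u = s \<and> v = p) \<or> s = q \<and> (u = p \<and> v = r \<or> u = r \<and> v = p)"

text \<open>In a triangle the second pair shares a letter with the first; testing this before the
  third pair is enumerated prunes the search early.\<close>

definition slides :: "'a list \<Rightarrow> 'a list list" where
  "slides w = [x @ [q, p] @ y @ [s, r] @ z @ [v, u] @ t.
    (x, p, q, w') \<leftarrow> pairs w, (y, r, s, w'') \<leftarrow> pairs w',
    r = p \<or> r = q \<or> s = p \<or> s = q, (z, u, v, t) \<leftarrow> pairs w'', triangle p q r s u v]"

text \<open>The eight orders are the left-hand sides of H3 and its three variants, and the four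
  corresponding right-hand sides, where \<open>p\<close> and \<open>q\<close> exchange their
  roles.\<close>

lemma homotopic_triangle:
  fixes p :: nat
  assumes G: "gauss_word (x @ [p, q] @ y @ [r, s] @ z @ [u, v] @ t)" and "triangle p q r s u v"
  shows "homotopic (x @ [p, q] @ y @ [r, s] @ z @ [u, v] @ t) (x @ [q, p] @ y @ [s, r] @ z @ [v, u] @ t)"
proof -
  have G': "gauss_word (x @ [q, p] @ y @ [s, r] @ z @ [v, u] @ t)"
    by (rule gauss_word_cong[OF G]) auto
  consider "r = p" "u = q" "v = s" | "r = p" "u = s" "v = q" | "s = p" "u = q" "v = r"
    | "s = p" "u = r" "v = q" | "r = q" "u = p" "v = s" | "r = q" "u = s" "v = p"
    | "s = q" "u = p" "v = r" | "s = q" "u = r" "v = p"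
    using assms(2) unfolding triangle_def by blast
  then show ?thesis
  proof cases
    case 1
    then show ?thesis using homotopic_H3[of x p q y s z t] G G' by simp
  next
    case 2
    then show ?thesis using homotopic_H3_variant2[of x p q y s z t] G G' by simp
  next
    case 3
    then show ?thesis using homotopic_H3_variant1[of x p q y r z t] G G' by simp
  next
    case 4
    then show ?thesis using homotopic_H3_variant3[of x p q y r z t] G G' by simp
  next
    case 5
    then show ?thesis using homotopic_sym[OF homotopic_H3_variant3[of x q p y s z t]] G G' by simp
  next
    case 6
    then show ?thesis using homotopic_sym[OF homotopic_H3_variant1[of x q p y s z t]] G G' by simp
  next
    case 7
    then show ?thesis using homotopic_sym[OF homotopic_H3_variant2[of x q p y r z t]] G G' by simp
  next
    case 8
    then show ?thesis using homotopic_H3_rev[of x p q y r z t] G G' by simp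
  qed
qed

lemma homotopic_slides:
  fixes w :: "nat list"
  assumes "gauss_word w" "v \<in> set (slides w)"
  shows "homotopic w v"
proof -
  obtain x p q w' y r s w'' z u v' t where *:
    "(x, p, q, w') \<in> set (pairs w)" "(y, r, s, w'') \<in> set (pairs w')" "(z, u, v', t) \<in> set (pairs w'')"
    "triangle p q r s u v'" "v = x @ [q, p] @ y @ [s, r] @ z @ [v', u] @ t"
    using assms(2) unfolding slides_def by (auto split: if_splits)
  then have "w = x @ [p, q] @ y @ [r, s] @ z @ [u, v'] @ t"
    by (auto dest!: set_pairs)
  then show ?thesis using homotopic_triangle assms(1) * by metis
qed

fun orbit :: "nat \<Rightarrow> 'a list \<Rightarrow> 'a list list" where
  "orbit 0 w = [w]"
| "orbit (Suc n) w = w # concat (map (orbit n) (slides w))"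

lemma homotopic_orbit:
  fixes w :: "nat list"
  shows "gauss_word w \<Longrightarrow> v \<in> set (orbit n w) \<Longrightarrow> homotopic w v"
proof (induction n arbitrary: w)
  case (Suc n)
  show ?case
  proof (cases "v = w")
    case False
    then obtain u where u: "u \<in> set (slides w)" "v \<in> set (orbit n u)"
      using Suc.prems(2) by auto
    have "homotopic w u" using homotopic_slides Suc.prems(1) u(1) by blast
    also have "homotopic u v" using Suc.IH u(2) homotopic_gauss(2)[OF calculation] by blast
    finally show ?thesis .
  qed (simp add: Suc.prems(1) homotopic_refl)
qed (simp add: homotopic_refl)

text \<open>Breadth-first search inside one list: the targets reached from \<open>F\<close> become
  the next frontier, and the others are passed on. So intermediate words are always targets
  themselves; \<open>n\<close> bounds the number of rounds.\<close>

fun slide_connected :: "nat \<Rightarrow> nat list list \<Rightarrow> nat list list \<Rightarrow> bool" where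
  "slide_connected 0 F T \<longleftrightarrow> T = []"
| "slide_connected (Suc n) F T \<longleftrightarrow> T = [] \<or>
    (case partition (\<lambda>t. t \<in> set (concat (map (map canon \<circ> slides) F))) T of
      (N, T') \<Rightarrow> slide_connected n N T')"

lemma homotopic_slide_connected:
  assumes "slide_connected n F T" "\<forall>f\<in>set F. gauss_word f" "t \<in> set T"
  shows "\<exists>f\<in>set F. homotopic f t"
  using assms
proof (induction n arbitrary: F T)
  case (Suc n)
  define P where "P t \<longleftrightarrow> t \<in> set (concat (map (map canon \<circ> slides) F))" for t
  have N: "\<exists>f\<in>set F. homotopic f t" if "P t" for t
  proof -
    from that obtain f v where f: "f \<in> set F" "v \<in> set (slides f)" "t = canon v"
      unfolding P_def by auto
    then have "homotopic f v" using homotopic_slides Suc.prems(2) by blast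
    also have "homotopic v t"
      using f(3) homotopic_if_canon_eq[of v t] homotopic_gauss(2)[OF calculation] by simp
    finally show ?thesis using f by blast
  qed
  show ?case
  proof (cases "P t")
    case False
    have "slide_connected n (filter P T) (filter (Not \<circ> P) T)"
      using Suc.prems(1,3) unfolding P_def by (auto simp: comp_def)
    moreover have "\<forall>f\<in>set (filter P T). gauss_word f" using N homotopic_gauss(2) by fastforce
    moreover have "t \<in> set (filter (Not \<circ> P) T)" using False Suc.prems(3) by simp
    ultimately obtain f where "P f" "homotopic f t" using Suc.IH by fastforce
    then show ?thesis using N homotopic_trans by meson
  qed (rule N)
qed simp

section \<open>Counting labelled subwords modulo 2\<close>

text \<open>
  \<open>odd_sum k w a\<close>: the positions of \<open>a\<close> in \<open>w\<close>, counted from \<open>k\<close>, have an odd sum. If \<open>a\<close> occurs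
  twice, this says that an even number of letters lie between its occurrences.
\<close>

fun odd_sum :: "bool \<Rightarrow> 'a list \<Rightarrow> 'a \<Rightarrow> bool" where
  "odd_sum k [] a \<longleftrightarrow> False"
| "odd_sum k (b # w) a \<longleftrightarrow> (b = a \<and> k) \<noteq> odd_sum (\<not> k) w a"

abbreviation "even_chord \<equiv> odd_sum False"

lemma odd_sum_append:
  "odd_sum k (u @ v) a \<longleftrightarrow> odd_sum k u a \<noteq> odd_sum (k \<noteq> odd (length u)) v a"
proof (induction u arbitrary: k)
  case (Cons b u)
  show ?case by (cases k; cases "odd (length u)"; cases "b = a"; simp add: Cons.IH)
qed simp

lemma odd_sum_notin: "a \<notin> set w \<Longrightarrow> \<not> odd_sum k w a"
  by (induction w arbitrary: k) auto

lemma odd_sum_map: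
  "inj_on f (insert a (set w)) \<Longrightarrow> odd_sum k (map f w) (f a) \<longleftrightarrow> odd_sum k w a"
  by (induction w arbitrary: k) (auto simp: inj_on_def)

text \<open>Letters are deleted with all their occurrences: for a distinct list \<open>as\<close> of
  letters of a Gauss word these are subdiagrams of its chord diagram, one for each set of deleted
  letters.\<close>

fun subwords :: "'a list \<Rightarrow> 'a list \<Rightarrow> 'a list list" where
  "subwords [] w = [w]"
| "subwords (a # as) w = subwords as w @ subwords as (removeAll a w)"

definition subword_sum :: "('a list \<Rightarrow> nat) \<Rightarrow> 'a list \<Rightarrow> 'a list \<Rightarrow> nat" where
  "subword_sum g as w = (\<Sum>s\<leftarrow>subwords as w. g s)"

lemma subword_sum_Nil [simp]: "subword_sum g [] w = g w"
  by (simp add: subword_sum_def)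

lemma subword_sum_Cons [simp]: "subword_sum g (a # as) w = subword_sum g as w + subword_sum g as (removeAll a w)"
  by (simp add: subword_sum_def)

lemma subword_sum_append: "subword_sum g (as @ bs) w = subword_sum (subword_sum g bs) as w"
  by (induction as arbitrary: w) auto

lemma removeAll_commute: "removeAll a (removeAll b w) = removeAll b (removeAll a w)"
  by (induction w) auto

lemma subword_sum_remove1: "a \<in> set as \<Longrightarrow> subword_sum g as w = subword_sum g (a # remove1 a as) w"
  by (induction as arbitrary: w) (auto simp: removeAll_commute[of _ a])

text \<open>The order is free because deletions commute. This allows the letters of a move to be put
  last, so that \<open>subword_sum_append\<close> splits off an inner sum over these letters
  alone.\<close>

lemma subword_sum_set:
  assumes "distinct as" "distinct bs" "set as = set bs"
  shows "subword_sum g as w = subword_sum g bs w"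
  using assms
proof (induction as arbitrary: bs w)
  case (Cons a as)
  have "subword_sum g as w' = subword_sum g (remove1 a bs) w'" for w'
    using Cons.prems by (intro Cons.IH) (auto simp: set_remove1_eq)
  moreover have "a \<in> set bs" using Cons.prems(3) by auto
  ultimately show ?case using subword_sum_remove1[of a bs g w] by simp
qed simp

lemma subword_sum_cong:
  "(\<And>s. set s \<subseteq> set w \<Longrightarrow> g s = h s) \<Longrightarrow> subword_sum g as w = subword_sum h as w"
proof (induction as arbitrary: w)
  case (Cons a as)
  have "subword_sum g as (removeAll a w) = subword_sum h as (removeAll a w)"
    by (rule Cons.IH) (use Cons.prems in auto)
  then show ?case using Cons by simp
qed simp

lemma removeAll_map:
  assumes "inj_on f (insert a (set w))"
  shows "removeAll (f a) (map f w) = map f (removeAll a w)"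
proof -
  have "f a = f b \<longleftrightarrow> a = b" if "b \<in> set w" for b
    using that inj_on_eq_iff[OF assms, of a b] by simp
  then have "filter (\<lambda>b. f a \<noteq> f b) w = filter (\<lambda>b. a \<noteq> b) w"
    by (metis (mono_tags, lifting) filter_cong)
  then show ?thesis by (simp add: removeAll_filter_not_eq filter_map comp_def)
qed

lemma subword_sum_map:
  "inj_on f (set as \<union> set w) \<Longrightarrow> subword_sum g (map f as) (map f w) = subword_sum (g \<circ> map f) as w"
proof (induction as arbitrary: w)
  case (Cons a as)
  have "inj_on f (set as \<union> set w)" "inj_on f (set as \<union> set (removeAll a w))" "inj_on f (insert a (set w))"
    by (rule inj_on_subset[OF Cons.prems]; auto)+
  then show ?case using Cons.IH by (simp add: removeAll_map)
qed simp

text \<open>\<open>R\<close> will say that two words differ by one fixed move in some context.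
  Deleting letters of the context preserves this, so parities need comparing only for the inner
  sums.\<close>

lemma even_subword_sum_cong:
  assumes "R u v"
    and "\<And>u v a. R u v \<Longrightarrow> a \<in> set as \<Longrightarrow> R (removeAll a u) (removeAll a v)"
    and "\<And>u v. R u v \<Longrightarrow> even (g u) \<longleftrightarrow> even (h v)"
  shows "even (subword_sum g as u) \<longleftrightarrow> even (subword_sum h as v)"
  using assms(1,2)
proof (induction as arbitrary: u v)
  case Nil
  then show ?case using assms(3) by simp
next
  case (Cons a as)
  have "even (subword_sum g as u) \<longleftrightarrow> even (subword_sum h as v)"
    "even (subword_sum g as (removeAll a u)) \<longleftrightarrow> even (subword_sum h as (removeAll a v))"
    by (rule Cons.IH; use Cons.prems in simp)+
  then show ?case by simp
qed

section \<open>The parity attached to a list of patterns\<close>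

type_synonym pattern = "nat list \<times> bool list"

definition weight :: "pattern list \<Rightarrow> ('a \<Rightarrow> bool) \<Rightarrow> 'a list \<Rightarrow> nat" where
  "weight P lab w = length (filter (\<lambda>p. fst p = canon w \<and> snd p = map lab w) P)"

text \<open>The labels are the parities in the whole word \<open>w\<close>; a subword inherits them
  instead of having its own.\<close>

definition invariant :: "pattern list \<Rightarrow> 'a list \<Rightarrow> bool" where
  "invariant P w \<longleftrightarrow> odd (subword_sum (weight P (even_chord w)) (remdups w) w)"

lemma weight_map:
  "inj_on f (set w) \<Longrightarrow> weight P lab (map f w) = weight P (lab \<circ> f) w"
  by (simp add: weight_def canon_map)

lemma weight_cong:
  "(\<And>a. a \<in> set w \<Longrightarrow> lab a = lab' a) \<Longrightarrow> weight P lab w = weight P lab' w"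
  by (simp add: weight_def cong: map_cong)

lemma weight_eq_0I:
  "(\<And>c l. (c, l) \<in> set P \<Longrightarrow> c = canon w \<Longrightarrow> l = map lab w \<Longrightarrow> False) \<Longrightarrow> weight P lab w = 0"
  unfolding weight_def length_0_conv filter_empty_conv by (metis prod.collapse)

lemma invariant_alt:
  "distinct as \<Longrightarrow> set as = set w \<Longrightarrow>
    invariant P w \<longleftrightarrow> odd (subword_sum (weight P (even_chord w)) as w)"
  unfolding invariant_def by (subst subword_sum_set[of _ "as"]) auto

lemma invariant_map:
  assumes "inj_on f (set w)"
  shows "invariant P (map f w) = invariant P w"
proof -
  have "subword_sum (weight P (even_chord (map f w))) (map f (remdups w)) (map f w)
      = subword_sum (weight P (even_chord (map f w)) \<circ> map f) (remdups w) w"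
    by (rule subword_sum_map) (use assms in simp)
  also have "\<dots> = subword_sum (weight P (even_chord w)) (remdups w) w"
  proof (rule subword_sum_cong)
    fix s assume s: "set s \<subseteq> set w"
    have "(even_chord (map f w) \<circ> f) a = even_chord w a" if "a \<in> set s" for a
    proof -
      have "insert a (set w) = set w" using that s by auto
      then show ?thesis using assms odd_sum_map[of f a w] by simp
    qed
    then have "weight P (even_chord (map f w) \<circ> f) s = weight P (even_chord w) s"
      by (rule weight_cong)
    then show "(weight P (even_chord (map f w)) \<circ> map f) s = weight P (even_chord w) s"
      by (simp add: weight_map[OF inj_on_subset[OF assms s]])
  qed
  finally show ?thesis
    using invariant_alt[of "map f (remdups w)" "map f w"] assms
    by (simp add: distinct_map invariant_def)
qed

section \<open>Conditions on the patterns that make the parity invariant\<close>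

definition loop_free :: "pattern \<Rightarrow> bool" where
  "loop_free p \<longleftrightarrow> (case p of (c, l) \<Rightarrow>
    list_all (\<lambda>i. \<not> (c ! i = c ! Suc i \<and> l ! i)) [0..<length c - 1])"

text \<open>Only the order \<open>ABBA\<close> is excluded, since it alone occurs in the generating
  moves. \<open>Suc i < j\<close> makes the two pairs disjoint.\<close>

definition bigon_free :: "pattern \<Rightarrow> bool" where
  "bigon_free p \<longleftrightarrow> (case p of (c, l) \<Rightarrow>
    list_all (\<lambda>i. list_all (\<lambda>j. \<not> (Suc i < j \<and> c ! i = c ! Suc j \<and> c ! Suc i = c ! j \<and> l ! i = l ! Suc i))
      [0..<length c - 1]) [0..<length c - 1])"

lemma weight_loop:
  assumes "list_all loop_free P" "lab A"
  shows "weight P lab (x @ [A, A] @ y) = 0"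
proof (rule weight_eq_0I)
  let ?w = "x @ [A, A] @ y"
  fix c l assume p: "(c, l) \<in> set P" "c = canon ?w" "l = map lab ?w"
  have "?w ! length x = A" "?w ! Suc (length x) = A" by (simp_all add: nth_append)
  then have "c ! length x = c ! Suc (length x)" "l ! length x" using p assms(2)
    by (simp_all add: canon_def nth_append)
  moreover have "length x \<in> set [0..<length c - 1]" using p by simp
  ultimately show False using assms(1) p(1) unfolding loop_free_def list_all_iff by fast
qed

lemma weight_bigon:
  assumes "list_all bigon_free P" "lab A = lab B"
  shows "weight P lab (x @ [A, B] @ y @ [B, A] @ z) = 0"
proof (rule weight_eq_0I)
  let ?w = "x @ [A, B] @ y @ [B, A] @ z"
  let ?i = "length x" and ?j = "length (x @ [A, B] @ y)"
  fix c l assume p: "(c, l) \<in> set P" "c = canon ?w" "l = map lab ?w"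
  have nth: "?w ! ?i = A" "?w ! Suc ?i = B" "?w ! ?j = B" "?w ! Suc ?j = A"
    by (simp_all add: nth_append)
  have len: "Suc ?i < length ?w" "Suc ?j < length ?w" by simp_all
  have "c ! ?i = c ! Suc ?j" "c ! Suc ?i = c ! ?j"
    unfolding p(2) canon_def using len nth by (metis Suc_lessD nth_map)+
  moreover have "l ! ?i = l ! Suc ?i"
    unfolding p(3) using len nth assms(2) by (metis Suc_lessD nth_map)
  moreover have "Suc ?i < ?j" by simp
  moreover have "?i \<in> set [0..<length c - 1]" "?j \<in> set [0..<length c - 1]"
    unfolding p(2) length_canon set_upt atLeastLessThan_iff using len by linarith+
  ultimately show False using assms(1) p(1) unfolding bigon_free_def list_all_iff by fast
qed

text \<open>Split both sides of H3 by the set of triangle letters that are kept. With at most one of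
  them kept the sides coincide and cancel modulo 2; the list holds the other four cases for each
  side.\<close>

definition triangle_terms :: "'a \<Rightarrow> 'a \<Rightarrow> 'a \<Rightarrow> 'a list \<Rightarrow> 'a list \<Rightarrow> 'a list \<Rightarrow> 'a list \<Rightarrow> 'a list list" where
  "triangle_terms A B C x y z t =
    [x @ [A, B] @ y @ [A, C] @ z @ [B, C] @ t, x @ [B, A] @ y @ [C, A] @ z @ [C, B] @ t,
     x @ [A, B] @ y @ [A] @ z @ [B] @ t, x @ [B, A] @ y @ [A] @ z @ [B] @ t,
     x @ [A] @ y @ [A, C] @ z @ [C] @ t, x @ [A] @ y @ [C, A] @ z @ [C] @ t,
     x @ [B] @ y @ [C] @ z @ [B, C] @ t, x @ [B] @ y @ [C] @ z @ [C, B] @ t]"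

text \<open>
  Labels for the letters 0 and 1 of a context and the letters 2, 3 and 4 of a triangle, of which an odd
  number are even.
\<close>

definition triangle_labels :: "bool list list" where
  "triangle_labels = [[k, l, a, b, a = b]. k \<leftarrow> [False, True], l \<leftarrow> [False, True],
    a \<leftarrow> [False, True], b \<leftarrow> [False, True]]"

text \<open>
  A rewriting step copies the terms it carries along, which makes a search through a long list of
  patterns expensive; a search tree keeps these terms small.
\<close>

datatype trie = Empty | Leaf "bool list" trie | Node nat trie trie

fun lookup :: "trie \<Rightarrow> nat list \<Rightarrow> bool list list" where
  "lookup Empty c = []"
| "lookup (Leaf l t) [] = l # lookup t []"
| "lookup (Leaf l t) (b # c) = lookup t (b # c)"
| "lookup (Node a t u) [] = lookup u []"
| "lookup (Node a t u) (b # c) = (if a = b then lookup t c else lookup u (b # c))"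

fun trie_insert :: "nat list \<Rightarrow> bool list \<Rightarrow> trie \<Rightarrow> trie" where
  "trie_insert [] l t = Leaf l t"
| "trie_insert (b # c) l Empty = Node b (trie_insert c l Empty) Empty"
| "trie_insert (b # c) l (Leaf m t) = Leaf m (trie_insert (b # c) l t)"
| "trie_insert (b # c) l (Node a t u) =
    (if a = b then Node a (trie_insert c l t) u else Node a t (trie_insert (b # c) l u))"

fun trie_of :: "pattern list \<Rightarrow> trie" where
  "trie_of [] = Empty"
| "trie_of ((c, l) # P) = trie_insert c l (trie_of P)"

lemma lookup_trie_insert: "lookup (trie_insert c l t) d = (if c = d then l # lookup t d else lookup t d)"
proof (induction c l t arbitrary: d rule: trie_insert.induct)
  case (1 l t)
  then show ?case by (cases d) auto
next
  case (2 b c l)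
  then show ?case by (cases d) auto
next
  case (3 b c l m t)
  then show ?case by (cases d) auto
next
  case (4 b c l a t u)
  then show ?case by (cases d) auto
qed

lemma lookup_trie_of: "lookup (trie_of P) c = map snd (filter (\<lambda>p. fst p = c) P)"
  by (induction P rule: trie_of.induct) (auto simp: lookup_trie_insert)

text \<open>
  The simplifier evaluates both sides of a conjunction, so list equality does not stop at the
  first difference; a conditional does.
\<close>

fun has_labels :: "bool list \<Rightarrow> nat list \<Rightarrow> bool list \<Rightarrow> bool" where
  "has_labels bs (i # w) (k # l) \<longleftrightarrow> (if bs ! i = k then has_labels bs w l else False)"
| "has_labels bs [] [] \<longleftrightarrow> True"
| "has_labels bs _ _ \<longleftrightarrow> False"

text \<open>The shapes are looked up once; the sixteen labellings are then tested against the hits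
  only.\<close>

fun hits :: "trie \<Rightarrow> nat list list \<Rightarrow> (nat list \<times> bool list) list" where
  "hits t [] = []"
| "hits t (w # ws) = map (Pair w) (lookup t (canon w)) @ hits t ws"

fun odd_hits :: "bool list \<Rightarrow> (nat list \<times> bool list) list \<Rightarrow> bool" where
  "odd_hits bs [] \<longleftrightarrow> False"
| "odd_hits bs (h # hs) \<longleftrightarrow> (if has_labels bs (fst h) (snd h) then \<not> odd_hits bs hs else odd_hits bs hs)"

fun even_hits :: "bool list list \<Rightarrow> (nat list \<times> bool list) list \<Rightarrow> bool" where
  "even_hits [] hs \<longleftrightarrow> True"
| "even_hits (bs # bss) hs \<longleftrightarrow> (if odd_hits bs hs then False else even_hits bss hs)"

definition even_weight :: "trie \<Rightarrow> nat list list \<Rightarrow> bool" where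
  "even_weight t ws \<longleftrightarrow> even_hits triangle_labels (hits t ws)"

text \<open>Every triangle term keeps at least two triangle letters and patterns have rank at most
  4, hence contexts of rank at most 2 suffice. Their letters are 0 and 1; those of the triangle are
  2, 3 and 4.\<close>

definition triangle_even :: "trie \<Rightarrow> bool" where
  "triangle_even t0 \<longleftrightarrow>
    list_all (\<lambda>n. list_all (\<lambda>c. list_all (\<lambda>(x, c'). list_all (\<lambda>(y, c''). list_all (\<lambda>(z, t).
      even_weight t0 (triangle_terms 2 3 4 x y z t))
      (splits c'')) (splits c')) (splits c)) (gauss_words n)) [0, 1, 2]"

lemma list_all_splits: "list_all (\<lambda>(u, v). Q u v) (splits w) \<longleftrightarrow> (\<forall>u v. w = u @ v \<longrightarrow> Q u v)"
  by (auto simp: list_all_iff set_splits)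

lemma even_weight_if_triangle_even:
  assumes "triangle_even t0" "n \<le> 2" "x @ y @ z @ t \<in> set (gauss_words n)"
  shows "even_weight t0 (triangle_terms 2 3 4 x y z t)"
proof -
  define Q where "Q c \<longleftrightarrow> (\<forall>x c'. c = x @ c' \<longrightarrow> (\<forall>y c''. c' = y @ c'' \<longrightarrow>
    (\<forall>z t. c'' = z @ t \<longrightarrow> even_weight t0 (triangle_terms 2 3 4 x y z t))))" for c
  have "n \<in> set [0, 1, 2]" using assms(2) by auto
  moreover have "list_all (\<lambda>n. list_all Q (gauss_words n)) [0, 1, 2]"
    using assms(1) unfolding triangle_even_def list_all_splits Q_def .
  ultimately have "Q (x @ y @ z @ t)" using assms(3) by (metis list_all_iff)
  then show ?thesis unfolding Q_def by blast
qed

definition admissible :: "pattern list \<Rightarrow> bool" where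
  "admissible P \<longleftrightarrow> list_all loop_free P \<and> list_all bigon_free P \<and>
    list_all (\<lambda>p. length (fst p) \<le> 8) P \<and> triangle_even (trie_of P)"

lemma has_labels_iff: "has_labels bs w l \<longleftrightarrow> map ((!) bs) w = l"
  by (induction bs w l rule: has_labels.induct) auto

lemma odd_hits_iff: "odd_hits bs hs \<longleftrightarrow> odd (length (filter (\<lambda>(w, l). map ((!) bs) w = l) hs))"
  by (induction hs) (auto simp: has_labels_iff)

lemma even_hits_iff: "even_hits bss hs \<longleftrightarrow> (\<forall>bs\<in>set bss. \<not> odd_hits bs hs)"
  by (induction bss) auto

lemma even_weightD:
  assumes "even_weight (trie_of P) ws" "bs \<in> set triangle_labels"
  shows "even (\<Sum>w\<leftarrow>ws. weight P ((!) bs) w)"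
proof -
  have "length (filter (\<lambda>(w, l). map ((!) bs) w = l) (hits (trie_of P) ws))
    = (\<Sum>w\<leftarrow>ws. weight P ((!) bs) w)"
    by (induction ws)
      (auto simp: weight_def lookup_trie_of filter_map comp_def intro!: arg_cong[of _ _ length] filter_cong)
  moreover have "\<not> odd_hits bs (hits (trie_of P) ws)"
    using assms by (simp add: even_weight_def even_hits_iff)
  ultimately show ?thesis by (simp add: odd_hits_iff)
qed

text \<open>A context of rank at least 3 makes every term longer than all patterns. Otherwise
  context and triangle are carried over to the standard letters, where the finite check
  applies.\<close>

lemma triangle_evenD:
  fixes A :: 'a
  assumes "admissible P" and lab: "lab C \<longleftrightarrow> (lab A \<longleftrightarrow> lab B)"
    and dist: "A \<noteq> B" "A \<noteq> C" "B \<noteq> C" "A \<notin> set (x @ y @ z @ t)" "B \<notin> set (x @ y @ z @ t)" "C \<notin> set (x @ y @ z @ t)"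
    and G: "gauss_word (x @ y @ z @ t)"
  shows "even (\<Sum>w\<leftarrow>triangle_terms A B C x y z t. weight P lab w)"
proof (cases "word_rank (x @ y @ z @ t) \<le> 2")
  case False
  then have len: "length x + length y + length z + length t \<ge> 6" using gauss_word_length[OF G] by simp
  have "weight P lab w = 0" if "w \<in> set (triangle_terms A B C x y z t)" for w
  proof (rule weight_eq_0I)
    fix c l assume "(c, l) \<in> set P" "c = canon w"
    then have "length w \<le> 8" using assms(1) by (auto simp: admissible_def list_all_iff)
    then show False using that len by (auto simp: triangle_terms_def)
  qed
  then have "map (weight P lab) (triangle_terms A B C x y z t) = map (\<lambda>_. 0) (triangle_terms A B C x y z t)"
    by (intro map_cong) auto
  then have "(\<Sum>w\<leftarrow>triangle_terms A B C x y z t. weight P lab w) = 0" by (simp only: sum_list_0)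
  then show ?thesis by (simp only: even_zero)
next
  case True
  define n where "n = word_rank (x @ y @ z @ t)"
  have "n \<le> 2" using True n_def by simp
  obtain c f where c: "c \<in> set (gauss_words n)" "inj_on f {..<n}" "x @ y @ z @ t = map f c"
    using gauss_words_complete[OF G] gauss_word_length[OF G] n_def by metis
  then obtain x' y' z' t' where c': "c = x' @ y' @ z' @ t'"
    "x = map f x'" "y = map f y'" "z = map f z'" "t = map f t'"
    by (auto simp: append_eq_map_conv)
  have set: "set x' \<union> set y' \<union> set z' \<union> set t' = {..<n}" using set_gauss_words[OF c(1)] c' by auto
  define h where "h = f(2 := A, 3 := B, 4 := C)"
  have h: "h i = f i" if "i < n" for i using that \<open>n \<le> 2\<close> by (simp add: h_def)
  have h': "h 2 = A" "h 3 = B" "h 4 = C" by (simp_all add: h_def)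
  have xs: "x = map h x'" "y = map h y'" "z = map h z'" "t = map h t'"
  proof -
    have hf: "map h w = map f w" if "set w \<subseteq> {..<n}" for w
      using that h by (auto intro!: map_cong)
    have "set x' \<subseteq> {..<n}" "set y' \<subseteq> {..<n}" "set z' \<subseteq> {..<n}" "set t' \<subseteq> {..<n}"
      using set by blast+
    then show "x = map h x'" "y = map h y'" "z = map h z'" "t = map h t'"
      by (simp_all only: c'(2-5) hf)
  qed
  have "f ` {..<n} = set (x @ y @ z @ t)" using c(3) set_gauss_words[OF c(1)] by simp
  then have ABC: "A \<notin> h ` {..<n}" "B \<notin> h ` {..<n}" "C \<notin> h ` {..<n}"
    using dist(4-6) image_cong[of "{..<n}" "{..<n}" h f] h by simp_all
  have "inj_on h {..<n}" using c(2) h by (simp add: inj_on_def)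
  moreover have "inj_on h {2, 3, 4}" using dist(1-3) h' by (simp add: inj_on_def)
  moreover have "h ` ({..<n} - {2, 3, 4}) \<inter> h ` ({2, 3, 4} - {..<n}) = {}"
  proof -
    have "h ` ({2, 3, 4} - {..<n}) \<subseteq> {A, B, C}" using h' by auto
    moreover have "h ` ({..<n} - {2, 3, 4}) \<subseteq> h ` {..<n}" by (intro image_mono Diff_subset)
    moreover have "h ` {..<n} \<inter> {A, B, C} = {}" using ABC by simp
    ultimately show ?thesis by (meson disjoint_iff subsetD)
  qed
  ultimately have inj: "inj_on h ({..<n} \<union> {2, 3, 4})" unfolding inj_on_Un by (intro conjI)
  \<comment> \<open>The labels as a table indexed by the standard letters. For \<open>n < 2\<close>
    the entries 0 and 1 need not belong to letters of the context; \<open>triangle_labels\<close>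
    admits both values there.\<close>
  define bs where "bs = map (lab \<circ> h) [0..<5]"
  have "bs = [lab (h 0), lab (h 1), lab (h 2), lab (h 3), lab (h 4)]"
    by (simp add: bs_def upt_rec numeral_eq_Suc)
  then have "bs = [lab (h 0), lab (h 1), lab A, lab B, lab A = lab B]" using h' lab by simp
  then have bs: "bs \<in> set triangle_labels"
    unfolding triangle_labels_def by (cases "lab (h 0)"; cases "lab (h 1)"; cases "lab A"; cases "lab B"; simp)
  have "even_weight (trie_of P) (triangle_terms 2 3 4 x' y' z' t')"
    using assms(1) c(1) c'(1) \<open>n \<le> 2\<close> by (intro even_weight_if_triangle_even) (auto simp: admissible_def)
  then have "even (\<Sum>w\<leftarrow>triangle_terms 2 3 4 x' y' z' t'. weight P ((!) bs) w)"
    using bs by (rule even_weightD)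
  moreover have "weight P ((!) bs) w = weight P lab (map h w)"
    if "w \<in> set (triangle_terms 2 3 4 x' y' z' t')" for w
  proof -
    have "set w \<subseteq> (set x' \<union> set y' \<union> set z' \<union> set t') \<union> {2, 3, 4}"
      using that by (auto simp: triangle_terms_def)
    then have sub: "set w \<subseteq> {..<n} \<union> {2, 3, 4}" unfolding set .
    have "bs ! i = (lab \<circ> h) i" if "i \<in> set w" for i
    proof -
      have "i < 5" using that sub \<open>n \<le> 2\<close> by auto
      then show ?thesis by (simp add: bs_def)
    qed
    then have "weight P ((!) bs) w = weight P (lab \<circ> h) w" by (rule weight_cong)
    then show ?thesis using weight_map[OF inj_on_subset[OF inj sub]] by metis
  qed
  then have "map (weight P ((!) bs)) (triangle_terms 2 3 4 x' y' z' t')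
    = map (weight P lab) (map (map h) (triangle_terms 2 3 4 x' y' z' t'))"
    by simp
  moreover have "map (map h) (triangle_terms 2 3 4 x' y' z' t') = triangle_terms A B C x y z t"
    by (simp add: triangle_terms_def xs h')
  ultimately show ?thesis by simp
qed


section \<open>Invariance under H1, H2 and H3\<close>

lemma gauss_word_removeAll: "gauss_word w \<Longrightarrow> gauss_word (removeAll a w)"
proof -
  have "count_list (removeAll a w) b = (if b = a then 0 else count_list w b)" for b
    by (induction w) auto
  then show "gauss_word w \<Longrightarrow> gauss_word (removeAll a w)" by (simp add: gauss_word_iff)
qed

text \<open>\<open>A\<close> is even, having no letter between its occurrences, so no pattern
  matches a subword that keeps it. The subwords without \<open>A\<close> are those of
  \<open>x @ y\<close>, with the same labels because the other positions shift by 0 or 2.\<close>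

lemma invariant_H1:
  assumes "admissible P" and G: "gauss_word (x @ [A, A] @ y)"
  shows "invariant P (x @ [A, A] @ y) = invariant P (x @ y)"
proof -
  let ?u = "x @ [A, A] @ y"
  define f where "f = weight P (even_chord ?u)"
  define g where "g = weight P (even_chord (x @ y))"
  have "count_list ?u A = 2" using G unfolding gauss_word_def by simp
  then have A: "A \<notin> set x" "A \<notin> set y" by (auto simp: count_list_0_iff)
  have lab: "even_chord ?u A" using A by (simp add: odd_sum_append odd_sum_notin)
  have lab': "even_chord ?u a = even_chord (x @ y) a" if "a \<noteq> A" for a
    using that by (simp add: odd_sum_append)
  let ?as = "remdups (x @ y)"
  define R where "R u v \<longleftrightarrow> (\<exists>x y. u = x @ [A, A] @ y \<and> v = x @ y \<and> A \<notin> set (x @ y))" for u v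
  have "even (subword_sum (subword_sum f [A]) ?as ?u) = even (subword_sum g ?as (x @ y))"
  proof (rule even_subword_sum_cong[where R = R])
    show "R ?u (x @ y)" using A unfolding R_def by auto
  next
    fix u v a assume "R u v" "a \<in> set ?as"
    then obtain x' y' where "u = x' @ [A, A] @ y'" "v = x' @ y'" "A \<notin> set (x' @ y')" "a \<noteq> A"
      using A unfolding R_def by auto
    then show "R (removeAll a u) (removeAll a v)"
      unfolding R_def by (intro exI[of _ "removeAll a x'"] exI[of _ "removeAll a y'"]) auto
  next
    fix u v assume "R u v"
    then obtain x' y' where uv: "u = x' @ [A, A] @ y'" "v = x' @ y'" "A \<notin> set (x' @ y')"
      unfolding R_def by auto
    have "f u = 0" unfolding f_def uv(1)
      using assms(1) lab by (intro weight_loop) (auto simp: admissible_def)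
    moreover have "f v = g v" unfolding f_def g_def
      using uv by (intro weight_cong lab') auto
    moreover have "removeAll A u = v" using uv by simp
    ultimately show "even (subword_sum f [A] u) = even (g v)" by simp
  qed
  moreover have "invariant P ?u = odd (subword_sum f (?as @ [A]) ?u)"
    unfolding f_def by (rule invariant_alt) (use A in auto)
  moreover have "invariant P (x @ y) = odd (subword_sum g ?as (x @ y))"
    unfolding g_def by (rule invariant_alt) auto
  ultimately show ?thesis by (simp only: subword_sum_append)
qed

lemma weight_replace:
  assumes "A \<notin> set (x @ y @ z)" "B \<notin> set (x @ y @ z)" "lab A = lab B"
  shows "weight P lab (x @ [A] @ y @ [A] @ z) = weight P lab (x @ [B] @ y @ [B] @ z)"
proof -
  let ?f = "id(A := B)"
  have "inj_on ?f (set (x @ [A] @ y @ [A] @ z))" using assms(1,2) by (auto simp: inj_on_def)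
  then have "weight P lab (map ?f (x @ [A] @ y @ [A] @ z)) = weight P (lab \<circ> ?f) (x @ [A] @ y @ [A] @ z)"
    by (rule weight_map)
  also have "\<dots> = weight P lab (x @ [A] @ y @ [A] @ z)"
    using assms(3) by (intro weight_cong) auto
  also have "map ?f (x @ [A] @ y @ [A] @ z) = x @ [B] @ y @ [B] @ z"
    using assms by simp
  finally show ?thesis ..
qed

text \<open>\<open>A\<close> and \<open>B\<close> have equal parity. Subwords keeping both have
  weight 0, those keeping just \<open>A\<close> and just \<open>B\<close> pair off with equal
  weights and cancel modulo 2, and those keeping neither are the subwords of
  \<open>x @ y @ z\<close>.\<close>

lemma invariant_H2:
  assumes "admissible P" and G: "gauss_word (x @ [A, B] @ y @ [B, A] @ z)"
  shows "invariant P (x @ [A, B] @ y @ [B, A] @ z) = invariant P (x @ y @ z)"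
proof -
  let ?u = "x @ [A, B] @ y @ [B, A] @ z" and ?v = "x @ y @ z"
  define f where "f = weight P (even_chord ?u)"
  define g where "g = weight P (even_chord ?v)"
  have "count_list ?u A = 2" "count_list ?u B = 2" using G unfolding gauss_word_def by simp_all
  then have AB: "A \<notin> set ?v" "B \<notin> set ?v" "A \<noteq> B" by (auto simp: count_list_0_iff split: if_splits)
  have lab: "even_chord ?u A = even_chord ?u B" using AB by (auto simp: odd_sum_append odd_sum_notin)
  have lab': "even_chord ?u a = even_chord ?v a" if "a \<noteq> A" "a \<noteq> B" for a
    using that by (simp add: odd_sum_append)
  let ?as = "remdups ?v"
  define R where "R u v \<longleftrightarrow> (\<exists>x y z. u = x @ [A, B] @ y @ [B, A] @ z \<and> v = x @ y @ z
    \<and> A \<notin> set (x @ y @ z) \<and> B \<notin> set (x @ y @ z))" for u v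
  have "even (subword_sum (subword_sum f [A, B]) ?as ?u) = even (subword_sum g ?as ?v)"
  proof (rule even_subword_sum_cong[where R = R])
    show "R ?u ?v" using AB unfolding R_def by blast
  next
    fix u v a assume "R u v" "a \<in> set ?as"
    then obtain x' y' z' where "u = x' @ [A, B] @ y' @ [B, A] @ z'" "v = x' @ y' @ z'"
      "A \<notin> set (x' @ y' @ z')" "B \<notin> set (x' @ y' @ z')" "a \<noteq> A" "a \<noteq> B"
      using AB unfolding R_def by auto
    then show "R (removeAll a u) (removeAll a v)"
      unfolding R_def
      by (intro exI[of _ "removeAll a x'"] exI[of _ "removeAll a y'"] exI[of _ "removeAll a z'"]) auto
  next
    fix u v assume "R u v"
    then obtain x' y' z' where uv: "u = x' @ [A, B] @ y' @ [B, A] @ z'" "v = x' @ y' @ z'"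
      "A \<notin> set (x' @ y' @ z')" "B \<notin> set (x' @ y' @ z')"
      unfolding R_def by auto
    have "f u = 0" unfolding f_def uv(1)
      using assms(1) lab by (intro weight_bigon) (auto simp: admissible_def)
    moreover have "f v = g v" unfolding f_def g_def
      using uv by (intro weight_cong lab') auto
    moreover have "f (x' @ [A] @ y' @ [A] @ z') = f (x' @ [B] @ y' @ [B] @ z')"
      unfolding f_def using uv lab by (intro weight_replace)
    moreover have "removeAll A u = x' @ [B] @ y' @ [B] @ z'" "removeAll B u = x' @ [A] @ y' @ [A] @ z'"
      "removeAll B (x' @ [B] @ y' @ [B] @ z') = v"
      using uv AB(3) by auto
    ultimately show "even (subword_sum f [A, B] u) = even (g v)"
      by (simp del: removeAll_append removeAll.simps) blast
  qed
  moreover have "invariant P ?u = odd (subword_sum f (?as @ [A, B]) ?u)"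
    unfolding f_def by (rule invariant_alt) (use AB in auto)
  moreover have "invariant P ?v = odd (subword_sum g ?as ?v)"
    unfolding g_def by (rule invariant_alt) auto
  ultimately show ?thesis by (simp only: subword_sum_append)
qed

lemma invariant_H3:
  assumes "admissible P" and G: "gauss_word (x @ [A, B] @ y @ [A, C] @ z @ [B, C] @ t)"
  shows "invariant P (x @ [A, B] @ y @ [A, C] @ z @ [B, C] @ t)
    = invariant P (x @ [B, A] @ y @ [C, A] @ z @ [C, B] @ t)"
proof -
  let ?u = "x @ [A, B] @ y @ [A, C] @ z @ [B, C] @ t" and ?v = "x @ [B, A] @ y @ [C, A] @ z @ [C, B] @ t"
  let ?w = "x @ y @ z @ t"
  define f where "f = weight P (even_chord ?u)"
  have "count_list ?u A = 2" "count_list ?u B = 2" "count_list ?u C = 2"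
    using G unfolding gauss_word_def by simp_all
  then have ABC: "A \<notin> set ?w" "B \<notin> set ?w" "C \<notin> set ?w" "A \<noteq> B" "A \<noteq> C" "B \<noteq> C"
    by (auto simp: count_list_0_iff split: if_splits)
  \<comment> \<open>The six places of the triangle form three neighbouring pairs, each with an odd
    sum of positions. So the total is odd, and an odd number of the three letters are even.\<close>
  have lab: "even_chord ?u C \<longleftrightarrow> (even_chord ?u A \<longleftrightarrow> even_chord ?u B)"
    using ABC by (auto simp: odd_sum_append odd_sum_notin)
  \<comment> \<open>Each triangle letter takes part in two of the three transpositions, so the sum
    of its positions changes by an even number.\<close>
  have "even_chord ?u a = even_chord ?v a" for a
    using ABC by (cases "a = A"; cases "a = B"; cases "a = C") (auto simp: odd_sum_append odd_sum_notin)
  then have lab': "even_chord ?u = even_chord ?v" by blast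
  have Gw: "gauss_word ?w"
    by (rule gauss_word_delete[OF G, of _ "[A, A, B, B, C, C]"]) (auto)
  let ?as = "remdups ?w"
  define R where "R u v \<longleftrightarrow> (\<exists>x y z t. u = x @ [A, B] @ y @ [A, C] @ z @ [B, C] @ t
    \<and> v = x @ [B, A] @ y @ [C, A] @ z @ [C, B] @ t
    \<and> A \<notin> set (x @ y @ z @ t) \<and> B \<notin> set (x @ y @ z @ t) \<and> C \<notin> set (x @ y @ z @ t)
    \<and> gauss_word (x @ y @ z @ t))" for u v
  have "even (subword_sum (subword_sum f [A, B, C]) ?as ?u) = even (subword_sum (subword_sum f [A, B, C]) ?as ?v)"
  proof (rule even_subword_sum_cong[where R = R])
    show "R ?u ?v" using ABC Gw unfolding R_def by blast
  next
    fix u v a assume "R u v" "a \<in> set ?as"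
    then obtain x' y' z' t' where uv: "u = x' @ [A, B] @ y' @ [A, C] @ z' @ [B, C] @ t'"
      "v = x' @ [B, A] @ y' @ [C, A] @ z' @ [C, B] @ t'"
      "A \<notin> set (x' @ y' @ z' @ t')" "B \<notin> set (x' @ y' @ z' @ t')" "C \<notin> set (x' @ y' @ z' @ t')"
      and Gw: "gauss_word (x' @ y' @ z' @ t')"
      unfolding R_def by blast
    have "a \<noteq> A" "a \<noteq> B" "a \<noteq> C" using ABC \<open>a \<in> set ?as\<close> by auto
    then show "R (removeAll a u) (removeAll a v)"
      unfolding R_def using uv gauss_word_removeAll[OF Gw, of a]
      by (intro exI[of _ "removeAll a x'"] exI[of _ "removeAll a y'"] exI[of _ "removeAll a z'"]
          exI[of _ "removeAll a t'"]) auto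
  next
    fix u v assume "R u v"
    then obtain x' y' z' t' where uv: "u = x' @ [A, B] @ y' @ [A, C] @ z' @ [B, C] @ t'"
      "v = x' @ [B, A] @ y' @ [C, A] @ z' @ [C, B] @ t'"
      and not: "A \<notin> set (x' @ y' @ z' @ t')" "B \<notin> set (x' @ y' @ z' @ t')" "C \<notin> set (x' @ y' @ z' @ t')"
      and Gw: "gauss_word (x' @ y' @ z' @ t')"
      unfolding R_def by blast
    \<comment> \<open>The subwords with at most one triangle letter are the same on both sides and
      therefore counted twice.\<close>
    define K where "K = f (x' @ y' @ z' @ t') + f (x' @ [A] @ y' @ [A] @ z' @ t')
      + f (x' @ [B] @ y' @ z' @ [B] @ t') + f (x' @ y' @ [C] @ z' @ [C] @ t')"
    have ne: "B \<noteq> A" "C \<noteq> A" "C \<noteq> B" using ABC by auto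
    have "even (\<Sum>w\<leftarrow>triangle_terms A B C x' y' z' t'. f w)"
      unfolding f_def by (rule triangle_evenD[OF assms(1) lab ABC(4-6) not Gw])
    moreover have "subword_sum f [A, B, C] u + subword_sum f [A, B, C] v
      = 2 * K + (\<Sum>w\<leftarrow>triangle_terms A B C x' y' z' t'. f w)"
      using not ABC(4-6) ne unfolding uv K_def by (simp add: triangle_terms_def)
    ultimately have "even (subword_sum f [A, B, C] u + subword_sum f [A, B, C] v)"
      by (simp only: even_add even_mult_iff) simp
    then show "even (subword_sum f [A, B, C] u) = even (subword_sum f [A, B, C] v)"
      by (simp only: even_add)
  qed
  moreover have "invariant P ?u = odd (subword_sum f (?as @ [A, B, C]) ?u)"
    unfolding f_def by (rule invariant_alt) (use ABC in auto)
  moreover have "invariant P ?v = odd (subword_sum f (?as @ [A, B, C]) ?v)"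
  proof -
    have "f = weight P (even_chord ?v)" unfolding f_def by (rule arg_cong[OF lab'])
    moreover have "distinct (?as @ [A, B, C])" "set (?as @ [A, B, C]) = set ?v" using ABC by auto
    ultimately show ?thesis using invariant_alt by metis
  qed
  ultimately show ?thesis by (simp only: subword_sum_append)
qed

theorem invariant_homotopic:
  fixes u v :: "'a list"
  assumes "admissible P" "homotopic u v"
  shows "invariant P u = invariant P v"
proof -
  have step: "invariant P u = invariant P v" if "homotopy_step u v" for u v :: "'a list"
  proof (cases "isomorphic u v")
    case True
    then show ?thesis using invariant_map unfolding isomorphic_def bij_betw_def by metis
  next
    case False
    then have "gauss_word u" "move u v" using that by (auto simp: homotopy_step_def)
    from this(2,1) show ?thesis
    proof cases
      case H1
      then show ?thesis using invariant_H1[OF assms(1)] \<open>gauss_word u\<close> by metis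
    next
      case H2
      then show ?thesis using invariant_H2[OF assms(1)] \<open>gauss_word u\<close> by metis
    next
      case H3
      then show ?thesis using invariant_H3[OF assms(1)] \<open>gauss_word u\<close> by metis
    qed
  qed
  have "equivclp homotopy_step u v" using assms(2) by (simp add: homotopic_def)
  then show ?thesis by (induction rule: equivclp_induct) (use step in auto)
qed


section \<open>Evaluation of the invariants by rewriting\<close>

fun list_eq :: "'a list \<Rightarrow> 'a list \<Rightarrow> bool" where
  "list_eq [] [] \<longleftrightarrow> True"
| "list_eq (a # u) (b # v) \<longleftrightarrow> (if a = b then list_eq u v else False)"
| "list_eq _ _ \<longleftrightarrow> False"

lemma list_eq_iff: "list_eq u v \<longleftrightarrow> u = v"
  by (induction u v rule: list_eq.induct) auto

fun odd_count :: "bool list \<Rightarrow> bool list list \<Rightarrow> bool" where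
  "odd_count l [] \<longleftrightarrow> False"
| "odd_count l (m # ls) \<longleftrightarrow> (if list_eq m l then \<not> odd_count l ls else odd_count l ls)"

fun odd_total :: "trie \<Rightarrow> pattern list \<Rightarrow> bool" where
  "odd_total t [] \<longleftrightarrow> False"
| "odd_total t (p # ps) \<longleftrightarrow> odd_count (snd p) (lookup t (fst p)) \<noteq> odd_total t ps"

fun odd_totals :: "trie list \<Rightarrow> pattern list \<Rightarrow> bool list" where
  "odd_totals [] ps = []"
| "odd_totals (t # ts) ps = odd_total t ps # odd_totals ts ps"

text \<open>Shapes and labels do not depend on the patterns, so one list serves all seven
  invariants.\<close>

definition labelled_subwords :: "'a list \<Rightarrow> pattern list" where
  "labelled_subwords w = map (\<lambda>s. (canon s, map (even_chord w) s)) (subwords (remdups w) w)"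

lemma odd_total_iff: "odd_total (trie_of P) (labelled_subwords w) \<longleftrightarrow> invariant P w"
proof -
  have count: "odd_count l ls \<longleftrightarrow> odd (length (filter (\<lambda>m. m = l) ls))" for l ls
    by (induction ls) (auto simp: list_eq_iff)
  have "weight P lab s = length (filter (\<lambda>m. m = map lab s) (lookup (trie_of P) (canon s)))"
    for lab and s :: "'a list"
    by (auto simp: weight_def lookup_trie_of filter_map comp_def conj_commute
        intro!: arg_cong[of _ _ length] filter_cong)
  moreover have "odd_total t ps \<longleftrightarrow>
    odd (\<Sum>p\<leftarrow>ps. length (filter (\<lambda>m. m = snd p) (lookup t (fst p))))" for t ps
    by (induction ps) (auto simp: count)
  ultimately show ?thesis
    by (simp add: invariant_def subword_sum_def labelled_subwords_def comp_def)
qed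

lemma odd_totals_iff:
  "odd_totals (map trie_of Ps) (labelled_subwords w) = map (\<lambda>P. invariant P w) Ps"
  by (induction Ps) (auto simp: odd_total_iff)

section \<open>The table\<close>

text \<open>Capitals stand for odd letters and small letters for even ones.\<close>

definition patterns :: "string list list" where
  "patterns =
    [
     [''aBBa''],
     [''aBcBca'', ''abCbCa''],
     [''AbAbCC'', ''aBaBCC'', ''abaCCb'', ''ABcAcB'', ''ABBcAc'', ''AbcbAc''],
     [''abaCbC'', ''aBaCCB'', ''abaCCb'', ''ABBCAC'', ''AbCbAC'', ''AbCCAb'', ''AbCCbA''],
     [''AABBCC'', ''AABcBc'', ''AbAbCC'', ''aBacBc'', ''AbCAbC'', ''ABBCAC'', ''aBBcac'',
      ''aBCCaB'', ''aBBCCa'', ''aBcBca''],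
     [''ABAcBDcD'', ''AbAcbDcD'', ''ABAcDBcD'', ''AbAcDbcD'', ''ABAcDBDc'', ''AbAcDbDc'',
      ''aBCaBDCD'', ''aBcaBDcD'', ''aBcaDBDc'', ''abcaDbDc'', ''aBCaCDBD'', ''abCaCDbD'',
      ''abCaDCDb'', ''abcaDcDb'', ''aBCBaDCD'', ''aBcBaDcD'', ''ABcBcDAD'', ''AbCbCDAD'',
      ''ABCBDCAD'', ''ABcBDcAD'', ''ABcDBDAc'', ''AbcDbDAc'', ''AbCdCdAb'', ''AbcDcDAb'',
      ''AbCdCdbA'', ''AbcDcDbA''],
     [''ABAcBc'', ''ABcBcA'', ''ABACdCdB'', ''ABAcDcDB'', ''ABcAdBcd'', ''AbCAdbCd'',
      ''ABcAdcBd'', ''AbCAdCbd'', ''ABCADCDB'', ''ABcAdcdB'', ''aBBCadCd'', ''aBCBadCd'',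
      ''aBCCadBd'', ''ABCdACdB'', ''ABcDAcDB'', ''ABCBdACd'', ''ABcBdAcd'', ''aBCBdaCd'',
      ''aBcBdacd'', ''ABCdCAdB'', ''ABcdcAdB'', ''aBCDCaDB'', ''aBCdCadB'', ''aBBcDcaD'',
      ''ABCBdCAd'', ''ABcBdcAd'', ''aBCBdCad'', ''aBcBdcad'', ''abCbDDaC'', ''abCCbDaD'',
      ''aBcDcBaD'', ''aBCdCdaB'', ''aBcDcDaB'', ''aBcDDcaB'', ''aBBCCDDa'', ''aBBCdCda'',
      ''aBcBcDDa'', ''ABcBDcDA'', ''ABcBdcdA'', ''aBCBdCda'', ''ABcDBcDA'', ''AbCdbCdA'',
      ''ABcDBDcA'', ''AbcDbDcA'', ''aBCdBdCa'', ''aBCCdBda'', ''ABcdcBdA'', ''AbCDCbDA'',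
      ''aBCCDDBa'', ''AbCdCdbA'', ''AbcDcDbA'', ''aBCdCdBa'', ''aBcDDcBa'']
    ]"

definition pattern_of :: "string \<Rightarrow> pattern" where
  "pattern_of s = (canon s, map (\<lambda>c. c \<in> set ''abcd'') s)"

lemma admissible_patterns: "list_all admissible (map (map pattern_of) patterns)"
  by code_simp

text \<open>The rows of the table, with the first row split into its two parts.\<close>

definition classes :: "string list list" where
  "classes = [[''ABCDBEACED'', ''ABCDECAEBD''], [''ABCADBECDE'', ''ABCACDEDBE'']] @ rows_from_2"

lemma length_classes: "length classes = 39"
  by (simp add: classes_def rows_from_2_def)

lemma table_row_1: "table_row 1 = word_of ` set (classes ! 0) \<union> word_of ` set (classes ! 1)"
  by (simp add: table_row_def classes_def w1_def w2_def w3_def w4_def)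

text \<open>The two halves of the first row occupy places 0 and 1 of \<open>classes\<close>, so from
  row 2 on place and row number agree.\<close>

lemma table_row_from_2: "i \<ge> 2 \<Longrightarrow> table_row i = word_of ` set (classes ! i)"
  by (simp add: table_row_def classes_def nth_append numeral_2_eq_2)

text \<open>Slides alone suffice: all words of a list are reached from its head through words of the
  same list. H1 and H2 enter only through the derivation of the slides.\<close>

lemma classes_connected:
  "list_all (\<lambda>ws. ws \<noteq> [] \<and> list_all gauss_word ws \<and> slide_connected 4 [hd ws] (tl ws))
    (map (map canon) classes)"
  by code_simp

lemma canon_word_of: "canon (word_of s) = canon s"
  unfolding word_of_def by (rule canon_map) (simp add: inj_on_def)

lemma homotopic_head:
  assumes "k < 39" "s \<in> set (classes ! k)"
  shows "homotopic (canon (hd (classes ! k))) (word_of s)"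
proof -
  let ?ws = "map canon (classes ! k)"
  have "classes ! k \<in> set classes" using assms(1) length_classes by simp
  then have ws: "?ws \<noteq> []" "\<forall>w\<in>set ?ws. gauss_word w" "slide_connected 4 [hd ?ws] (tl ?ws)"
    using classes_connected unfolding list_all_iff by (auto simp: list_all_iff)
  have "homotopic (hd ?ws) (canon s)"
  proof (cases "canon s = hd ?ws")
    case True
    have "gauss_word (canon s)" using ws(2) assms(2) by simp
    then show ?thesis unfolding True[symmetric] by (rule homotopic_refl)
  next
    case False
    then have "canon s \<in> set (tl ?ws)"
      using assms(2) by (cases "classes ! k") auto
    moreover have "gauss_word (hd ?ws)" using ws(1,2) hd_in_set by blast
    ultimately show ?thesis using homotopic_slide_connected[OF ws(3)] by simp
  qed
  also have "homotopic (canon s) (word_of s)"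
    using homotopic_gauss(2)[OF calculation] by (rule homotopic_if_canon_eq) (simp add: canon_word_of)
  also have "hd ?ws = canon (hd (classes ! k))" using ws(1) by (simp add: hd_map)
  finally show ?thesis .
qed

lemma homotopic_class:
  assumes "k < 39" "u \<in> word_of ` set (classes ! k)" "v \<in> word_of ` set (classes ! k)"
  shows "homotopic u v"
  using assms homotopic_head homotopic_sym homotopic_trans by blast

section \<open>Separation of the rows\<close>

definition signature :: "'a list \<Rightarrow> bool list" where
  "signature w = map (\<lambda>P. invariant P w) (map (map pattern_of) patterns)"

lemma signature_homotopic:
  assumes "homotopic u v"
  shows "signature u = signature v"
  unfolding signature_def
proof (intro map_cong refl)
  fix P assume "P \<in> set (map (map pattern_of) patterns)"
  then have "admissible P" using admissible_patterns unfolding list_all_iff by blast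
  then show "invariant P u = invariant P v" using assms by (rule invariant_homotopic)
qed

lemma signature_odd_totals:
  "signature w = odd_totals (map trie_of (map (map pattern_of) patterns)) (labelled_subwords w)"
  by (simp only: signature_def odd_totals_iff)

text \<open>The first two entries may coincide: they come from the two halves of the first row,
  whose equivalence is left open.\<close>

fun separated :: "'b list \<Rightarrow> bool" where
  "separated (s # t # ss) \<longleftrightarrow> distinct (t # ss) \<and> s \<notin> set ss"
| "separated _ \<longleftrightarrow> False"

lemma signatures_separated:
  "separated (map (\<lambda>ss. odd_totals (map trie_of (map (map pattern_of) patterns))
    (labelled_subwords (canon (hd ss)))) classes)"
  by code_simp

text \<open>Given \<open>j < k\<close>, the bound on \<open>k\<close> from below excludes exactly
  the pair 0, 1 that \<open>separated\<close> leaves open.\<close>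

lemma signatures_differ:
  assumes "j < k" "k < 39" "2 \<le> k"
  shows "signature (canon (hd (classes ! j))) \<noteq> signature (canon (hd (classes ! k)))"
proof -
  define S where "S = map (\<lambda>ss. signature (canon (hd ss))) classes"
  have "separated S" using signatures_separated unfolding S_def signature_odd_totals .
  then obtain s t ss where S: "S = s # t # ss" "distinct (t # ss)" "s \<notin> set ss"
    by (cases S rule: separated.cases) auto
  have len: "length S = 39" by (simp add: S_def length_classes)
  have "S ! j \<noteq> S ! k"
  proof (cases j)
    case 0
    have "S ! k \<in> set ss" using assms len S(1) by (auto simp: nth_Cons split: nat.splits)
    then show ?thesis using 0 S by auto
  next
    case (Suc j')
    obtain k' where "k = Suc k'" using assms(1) by (cases k) auto
    then show ?thesis using Suc S len assms nth_eq_iff_index_eq[OF S(2), of j' k'] by auto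
  qed
  then show ?thesis using assms by (simp add: S_def length_classes)
qed

lemma not_homotopic_classes:
  assumes "j < k" "k < 39" "2 \<le> k" "u \<in> word_of ` set (classes ! j)" "v \<in> word_of ` set (classes ! k)"
  shows "\<not> homotopic u v"
proof
  assume "homotopic u v"
  moreover have "homotopic (canon (hd (classes ! j))) u" "homotopic (canon (hd (classes ! k))) v"
    using assms homotopic_head by auto
  ultimately show False using signatures_differ[OF assms(1-3)] signature_homotopic by metis
qed

section \<open>Reduction of the unlisted words of rank 5\<close>

lemma length_orbit: "v \<in> set (orbit n w) \<Longrightarrow> length v = length w"
proof (induction n arbitrary: w)
  case (Suc n)
  have "length u = length w" if "u \<in> set (slides w)" for u
    using that unfolding slides_def by (auto dest!: set_pairs split: if_splits)
  then show ?case using Suc by fastforce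
qed simp

text \<open>The search tree serves as a set here: a word belongs to it if the lookup is nonempty,
  and the empty label list is a mere placeholder.\<close>

definition listed :: trie where
  "listed = trie_of (map (\<lambda>s. (canon s, [])) (concat classes))"

text \<open>The conditionals order the tests by cost, so that the orbit is searched only for
  unlisted words without loop and bigon. By \<open>rank_5_words\<close>, three slides are enough for
  these.\<close>

definition reducible_or_listed :: "trie \<Rightarrow> nat list \<Rightarrow> bool" where
  "reducible_or_listed t w \<longleftrightarrow>
    (if has_loop w \<or> has_bigon w then True else if lookup t (canon w) \<noteq> [] then True
     else list_ex (\<lambda>v. has_loop v \<or> has_bigon v) (orbit 3 w))"

lemma rank_5_words: "list_all (reducible_or_listed listed) (gauss_words 5)"
  by code_simp

lemma rank_5_reduces:
  assumes "gauss_word w" "word_rank w = 5" "\<And>s. s \<in> set (concat classes) \<Longrightarrow> \<not> isomorphic w (word_of s)"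
  shows "\<exists>v :: nat list. homotopic w v \<and> word_rank v < 5"
proof -
  obtain c f where c: "c \<in> set (gauss_words 5)" "inj_on f {..<5}" "w = map f c"
    using gauss_words_complete[OF assms(1), of 5] gauss_word_length[OF assms(1)] assms(2) by auto
  have canon: "canon w = canon c" using c set_gauss_words[OF c(1)] by (simp add: canon_map)
  have G: "gauss_word c" using c(1) by (rule gauss_word_gauss_words)
  have rank: "word_rank c = 5" using set_gauss_words[OF c(1)] by (simp add: word_rank_def)
  have "canon s \<noteq> canon c" if "s \<in> set (concat classes)" for s
    using assms(3)[OF that] canon isomorphic_if_canon_eq canon_word_of by metis
  then have "lookup listed (canon c) = []"
    by (simp add: listed_def lookup_trie_of filter_empty_conv del: set_concat)
  moreover have "reducible_or_listed listed c" using rank_5_words c(1) by (simp add: list_all_iff)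
  ultimately have "has_loop c \<or> has_bigon c \<or> (\<exists>u\<in>set (orbit 3 c). has_loop u \<or> has_bigon u)"
    unfolding reducible_or_listed_def list_ex_iff by (auto split: if_splits)
  moreover have "c \<in> set (orbit 3 c)" by (simp add: numeral_eq_Suc)
  ultimately have "\<exists>u\<in>set (orbit 3 c). has_loop u \<or> has_bigon u" by blast
  then obtain u where u: "u \<in> set (orbit 3 c)" "has_loop u \<or> has_bigon u" by blast
  have "homotopic w c" using assms(1) canon by (rule homotopic_if_canon_eq)
  also have "homotopic c u" using G u(1) by (rule homotopic_orbit)
  finally have wu: "homotopic w u" .
  \<comment> \<open>Slides keep the length and thus the rank, so removing a loop or bigon of
    \<open>u\<close> leads below 5.\<close>
  have ru: "word_rank u = 5"
    using length_orbit[OF u(1)] gauss_word_length[OF G] gauss_word_length[OF homotopic_gauss(2)[OF wu]] rank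
    by simp
  show ?thesis using reducible[OF homotopic_gauss(2)[OF wu] u(2)] ru wu homotopic_trans by metis
qed

theorem theorem5p3:
  shows
    "((\<forall>i\<in>{2..38}. \<forall>u\<in>table_row i. \<forall>v\<in>table_row i. homotopic u v) \<and> homotopic w1 w2 \<and> homotopic w3 w4)
     \<and> (\<forall>i\<in>{1..38}. \<forall>j\<in>{1..38}. i \<noteq> j \<longrightarrow> (\<forall>u\<in>table_row i. \<forall>v\<in>table_row j. \<not> homotopic u v))
     \<and> (\<forall>w :: nat list. gauss_word w \<and> word_rank w \<le> 5 \<and> \<not> (\<exists>i\<in>{1..38}. \<exists>v\<in>table_row i. isomorphic w v) \<longrightarrow>
          homotopic w [] \<or> (\<exists>v :: nat list. gauss_word v \<and> word_rank v \<le> 4 \<and> homotopic w v))"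
proof (intro conjI)
  show "\<forall>i\<in>{2..38}. \<forall>u\<in>table_row i. \<forall>v\<in>table_row i. homotopic u v"
  proof (intro ballI)
    fix i u v assume "i \<in> {2..38}" "u \<in> table_row i" "v \<in> table_row i"
    then show "homotopic u v" using homotopic_class[of i u v] by (simp add: table_row_from_2)
  qed
  show "homotopic w1 w2"
    by (rule homotopic_class[of 0]) (simp_all add: classes_def w1_def w2_def)
  show "homotopic w3 w4"
    by (rule homotopic_class[of 1]) (simp_all add: classes_def w3_def w4_def)
  have lt: "\<not> homotopic u v" if "1 \<le> i" "i < j" "j \<le> 38" "u \<in> table_row i" "v \<in> table_row j" for i j u v
  proof -
    have v: "v \<in> word_of ` set (classes ! j)" using that table_row_from_2[of j] by simp
    \<comment> \<open>The class of \<open>u\<close> stands at place \<open>i\<close>, or at 0 or 1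
      if \<open>i = 1\<close>; in each case below \<open>j\<close>, which is at least 2.\<close>
    have "\<exists>k<j. u \<in> word_of ` set (classes ! k)"
    proof (cases "i = 1")
      case True
      then have "u \<in> word_of ` set (classes ! 0) \<or> u \<in> word_of ` set (classes ! 1)"
        using that(4) table_row_1 by blast
      then show ?thesis using that(2) True by (metis less_trans zero_less_one)
    next
      case False
      then show ?thesis using that table_row_from_2[of i] by auto
    qed
    then obtain k where "k < j" "u \<in> word_of ` set (classes ! k)" by blast
    then show ?thesis using not_homotopic_classes[OF _ _ _ _ v] that by auto
  qed
  show "\<forall>i\<in>{1..38}. \<forall>j\<in>{1..38}. i \<noteq> j \<longrightarrow> (\<forall>u\<in>table_row i. \<forall>v\<in>table_row j. \<not> homotopic u v)"
    using lt homotopic_sym by (metis atLeastAtMost_iff linorder_neq_iff)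
  show "\<forall>w :: nat list. gauss_word w \<and> word_rank w \<le> 5 \<and> \<not> (\<exists>i\<in>{1..38}. \<exists>v\<in>table_row i. isomorphic w v) \<longrightarrow>
    homotopic w [] \<or> (\<exists>v :: nat list. gauss_word v \<and> word_rank v \<le> 4 \<and> homotopic w v)"
  \<comment> \<open>The second alternative always holds, the empty word itself having rank
    0.\<close>
  proof (intro allI impI disjI2, elim conjE)
    fix w :: "nat list"
    assume w: "gauss_word w" "word_rank w \<le> 5" "\<not> (\<exists>i\<in>{1..38}. \<exists>v\<in>table_row i. isomorphic w v)"
    show "\<exists>v :: nat list. gauss_word v \<and> word_rank v \<le> 4 \<and> homotopic w v"
    proof (cases "word_rank w \<le> 4")
      case True
      then show ?thesis using w(1) homotopic_refl by blast
    next
      case False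
      have "\<not> isomorphic w (word_of s)" if s: "s \<in> set (concat classes)" for s
      proof -
        obtain k where k: "k < 39" "s \<in> set (classes ! k)"
        proof -
          obtain ss where "ss \<in> set classes" "s \<in> set ss" using s by auto
          then show thesis using that length_classes by (metis in_set_conv_nth)
        qed
        \<comment> \<open>Places 0 and 1 both belong to the first row, hence the maximum.\<close>
        have "word_of s \<in> table_row (max 1 k)"
        proof (cases "k \<ge> 2")
          case True
          then show ?thesis using k table_row_from_2[of k] by (simp add: max_def)
        next
          case False
          then have "k = 0 \<or> k = 1" by linarith
          then show ?thesis using k table_row_1 by auto
        qed
        moreover have "max 1 k \<in> {1..38}" using k(1) by auto
        ultimately show ?thesis using w(3) by blast
      qed
      then obtain v where "homotopic w v" "word_rank v < 5"
        using rank_5_reduces[of w] w(1,2) False by force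
      then show ?thesis using homotopic_gauss(2) by (intro exI[of _ v]) auto
    qed
  qed
qed

end
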